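(* Let $\alpha\in(0,1)$, $\beta\in(0,1]$ and $\frac{1}{\alpha\beta}<p<\infty$. Let $B^{\alpha,\beta}=(B^{\alpha,\beta}(t))_{t\in[0,1]}$ be a bifractional Brownian motion with parameters $\alpha,\beta$, and let $B^{\alpha,\beta}(\cdot)$ denote its sample paths $t\in[0,1]\mapsto B^{\alpha,\beta}(t)$. Then $$\mathbb{P}\big(B^{\alpha,\beta}(\cdot)\in \mathbf{Bes}(\alpha\beta,p)\big)=1\qquad\text{and}\qquad \mathbb{P}\big(B^{\alpha,\beta}(\cdot)\in \mathbf{bes}(\alpha\beta,p)\big)=0.$$
   Context: Bifractional Brownian motion with parameters $\alpha\in(0,1)$, $\beta\in(0,1]$: a centred real-valued Gaussian process $(B^{\alpha,\beta}(t))_{t\ge 0}$ (here restricted to $t\in[0,1]$), with continuous sample paths, whose covariance function is $$R(s,t)=\frac{1}{2^\beta}\left((t^{2\alpha}+s^{2\alpha})^\beta-|t-s|^{2\alpha\beta}\right).$$ Besov spaces on $I=[0,1]$: for $1\le p<\infty$, $f\in L^p(I;\mathbb{R})$ and $t>0$ put $$\Delta_p(f,I)(t)=\sup_{|s|\le t}\left\{\int_{I_s}|f(x+s)-f(x)|^p\,dx\right\}^{1/p},\qquad I_s=\{x\in I:\ x+s\in I\}.$$ For $\gamma>0$ let $\|f\|_{\gamma,p}=\|f\|_{L^p(I)}+\sup_{0<t\le 1}\frac{\Delta_p(f,I)(t)}{t^\gamma}$. Then $$\mathbf{Bes}(\gamma,p)=\{f\in L^p(I):\ \|f\|_{\gamma,p}<\infty\},\qquad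 \mathbf{bes}(\gamma,p)=\{f\in L^p(I):\ \Delta_p(f,I)(t)=o(t^\gamma)\ \text{as}\ t\to0^+\}.$$ *)

theory Defs
  imports "HOL-Probability.Probability" "HOL-Library.Landau_Symbols"
begin

text \<open>Constant random variables count as Gaussian (variance zero); this is needed because
  bifractional Brownian motion vanishes almost surely at time zero.\<close>

definition gaussian_rv :: "'a measure \<Rightarrow> ('a \<Rightarrow> real) \<Rightarrow> bool" where
  "gaussian_rv M Y \<longleftrightarrow> Y \<in> borel_measurable M \<and>
     ((\<exists>m. AE \<omega> in M. Y \<omega> = m) \<or>
      (\<exists>m \<sigma>. \<sigma> > 0 \<and> distributed M lborel Y (\<lambda>x. ennreal (normal_density m \<sigma> x))))"

definition gaussian_process :: "'a measure \<Rightarrow> 'i set \<Rightarrow> ('i \<Rightarrow> 'a \<Rightarrow> real) \<Rightarrow> bool" where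
  "gaussian_process M T X \<longleftrightarrow>
     (\<forall>J c. finite J \<and> J \<subseteq> T \<longrightarrow> gaussian_rv M (\<lambda>\<omega>. \<Sum>t\<in>J. c t * X t \<omega>))"

definition covariance :: "'a measure \<Rightarrow> ('a \<Rightarrow> real) \<Rightarrow> ('a \<Rightarrow> real) \<Rightarrow> real" where
  "covariance M X Y =
     (\<integral>\<omega>. (X \<omega> - (\<integral>\<omega>'. X \<omega>' \<partial>M)) * (Y \<omega> - (\<integral>\<omega>'. Y \<omega>' \<partial>M)) \<partial>M)"

definition bifractional_cov :: "real \<Rightarrow> real \<Rightarrow> real \<Rightarrow> real \<Rightarrow> real" where
  "bifractional_cov \<alpha> \<beta> s t =
     1 / 2 powr \<beta> *
       ((t powr (2 * \<alpha>) + s powr (2 * \<alpha>)) powr \<beta> - \<bar>t - s\<bar> powr (2 * \<alpha> * \<beta>))"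

text \<open>The time set \<open>T\<close> is a set of nonnegative reals, such as \<open>{0..}\<close> or \<open>{0..1}\<close>. Only the values
  of the process at times in \<open>T\<close> are constrained.\<close>

definition bifractional_brownian_motion ::
    "'a measure \<Rightarrow> real set \<Rightarrow> real \<Rightarrow> real \<Rightarrow> (real \<Rightarrow> 'a \<Rightarrow> real) \<Rightarrow> bool" where
  "bifractional_brownian_motion M T \<alpha> \<beta> B \<longleftrightarrow>
     prob_space M \<and>
     gaussian_process M T B \<and>
     (\<forall>t\<in>T. (\<integral>\<omega>. B t \<omega> \<partial>M) = 0) \<and>
     (\<forall>s\<in>T. \<forall>t\<in>T. covariance M (B s) (B t) = bifractional_cov \<alpha> \<beta> s t) \<and>
     (\<forall>\<omega>\<in>space M. continuous_on T (\<lambda>t. B t \<omega>))"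

text \<open>Elements of \<open>L\<^sup>p\<close> are represented by functions on the whole real line; all notions below
  depend only on the restriction to \<open>I\<close>.\<close>

definition Lp_fun :: "real \<Rightarrow> real set \<Rightarrow> (real \<Rightarrow> real) set" where
  "Lp_fun p I = {f. set_borel_measurable lebesgue I f \<and>
                    set_integrable lebesgue I (\<lambda>x. \<bar>f x\<bar> powr p)}"

definition Lp_norm :: "real \<Rightarrow> real set \<Rightarrow> (real \<Rightarrow> real) \<Rightarrow> real" where
  "Lp_norm p I f = (set_lebesgue_integral lebesgue I (\<lambda>x. \<bar>f x\<bar> powr p)) powr (1 / p)"

text \<open>For \<open>f\<close> in \<open>L\<^sup>p(I)\<close> the integrals are finite and, by Minkowski's inequality, the set of
  values is bounded by twice the \<open>L\<^sup>p\<close> norm, so the real-valued supremum is the true one.\<close>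

definition Lp_modulus :: "real \<Rightarrow> real set \<Rightarrow> (real \<Rightarrow> real) \<Rightarrow> real \<Rightarrow> real" where
  "Lp_modulus p I f t =
     (SUP s\<in>{s. \<bar>s\<bar> \<le> t}.
        (set_lebesgue_integral lebesgue {x\<in>I. x + s \<in> I} (\<lambda>x. \<bar>f (x + s) - f x\<bar> powr p))
          powr (1 / p))"

definition besov_norm :: "real \<Rightarrow> real \<Rightarrow> (real \<Rightarrow> real) \<Rightarrow> ennreal" where
  "besov_norm \<gamma> p f =
     ennreal (Lp_norm p {0..1} f) +
     (SUP t\<in>{0<..1}. ennreal (Lp_modulus p {0..1} f t / t powr \<gamma>))"

definition Bes :: "real \<Rightarrow> real \<Rightarrow> (real \<Rightarrow> real) set" where
  "Bes \<gamma> p = {f \<in> Lp_fun p {0..1}. besov_norm \<gamma> p f < \<infinity>}"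

definition bes :: "real \<Rightarrow> real \<Rightarrow> (real \<Rightarrow> real) set" where
  "bes \<gamma> p = {f \<in> Lp_fun p {0..1}.
     Lp_modulus p {0..1} f \<in> o[at_right 0](\<lambda>t. t powr \<gamma>)}"

end

theory Submission
  imports Defs "HOL-Computational_Algebra.Polynomial"
begin

text \<open>Put \<open>H = \<alpha> * \<beta>\<close>. By subadditivity and convexity of \<open>x powr p\<close>, the \<open>L\<^sup>p\<close> size of
  the increments of a continuous path over an arbitrary step is controlled by its size over the
  dyadic steps \<open>2\<^sup>-\<^sup>j\<close>. Hence the path lies in \<open>Bes H p\<close> (resp. \<open>bes H p\<close>) iff the
  integrals \<open>V p j\<close> of the \<open>p\<close>-th powers of the increments over \<open>2\<^sup>-\<^sup>j\<close>, normalised by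
  \<open>2 powr (j * H)\<close>, are bounded in \<open>j\<close> (resp. tend to \<open>0\<close>).

  For even \<open>p\<close> these integrals obey a law of large numbers. The covariance of even powers of two
  jointly Gaussian variables is at most a constant times the modulus of their covariance, and the
  double integral of the modulus of the covariance of increments telescopes, because the mixed
  differences of both terms of the covariance function have a constant sign off the diagonal. So the
  variances decay geometrically in \<open>j\<close>. General exponents are compared with the exponents \<open>2\<close>,
  \<open>4\<close> and a large even integer by pointwise inequalities.\<close>

subsection \<open>Besov spaces and dyadic increments\<close>

text \<open>The increments are not stationary, so the means of the normalised even-power integrals
  are never computed. It suffices that they are bounded and, for the second power, bounded below.
  The lower bound comes from times in the right half of the interval, where the deviation of the
  variance from \<open>2 powr (1 - \<beta>) * h powr (2 * H)\<close> is of lower order in the step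
  \<open>h\<close>. A covariance estimate that is only linear in the modulus of the covariance is
  affordable: for raw increments the double integral of that modulus is of order
  \<open>h powr (1 + min 1 (2 * H))\<close>, and normalising divides by
  \<open>h powr (2 * H)\<close>. Since \<open>H < 1\<close> a positive power of \<open>h\<close>
  remains; for \<open>h = 2 powr - j\<close> it is summable, which gives almost sure convergence
  along all \<open>j\<close>. The exponents 2 and 4 exclude \<open>bes\<close>: if the
  \<open>p\<close>-th power integrals tended to zero, the mass of the squares would have to sit at
  tiny values, where it is negligible, or at huge values, which bounded fourth powers forbid. A
  large even exponent dominates \<open>p\<close> and gives \<open>Bes\<close>.\<close>

definition Lp_incr :: "real \<Rightarrow> (real \<Rightarrow> real) \<Rightarrow> real \<Rightarrow> real" where
  "Lp_incr p f h = (LBINT x:{0..1 - h}. \<bar>f (x + h) - f x\<bar> powr p)"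

lemma set_integral_lebesgue_eq_lborel:
  fixes f :: "real \<Rightarrow> real"
  assumes "set_integrable lborel A f"
  shows "set_lebesgue_integral lebesgue A f = set_lebesgue_integral lborel A f"
  using assms unfolding set_lebesgue_integral_def set_integrable_def
  by (intro integral_completion) simp

text \<open>Jensen's inequality for \<open>a + b = l * (a / l) + (1 - l) * (b / (1 - l))\<close>.
  The weight is left free because the dyadic induction needs an uneven split; the symmetric choice
  would not contract for every \<open>H\<close>.\<close>

lemma powr_convex_combination_le:
  fixes a b :: real
  assumes "1 \<le> p" "0 < l" "l < 1"
  shows "\<bar>a + b\<bar> powr p \<le> l powr (1 - p) * \<bar>a\<bar> powr p + (1 - l) powr (1 - p) * \<bar>b\<bar> powr p"
proof -
  have one: "1 \<le> t powr (1 - p)" if "0 < t" "t < 1" for t :: real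
    using powr_mono'[of "1 - p" 0 t] assms(1) that by simp
  have scale: "t * (x / t) powr p = t powr (1 - p) * x powr p" if "0 < t" "0 \<le> x" for t x :: real
    using that by (simp add: powr_divide powr_diff)
  have "\<bar>a + b\<bar> powr p \<le> (\<bar>a\<bar> + \<bar>b\<bar>) powr p"
    using assms by (intro powr_mono2) auto
  also have "\<dots> \<le> l powr (1 - p) * \<bar>a\<bar> powr p + (1 - l) powr (1 - p) * \<bar>b\<bar> powr p"
  proof (cases "a = 0 \<or> b = 0")
    case True
    then show ?thesis
      using one[of l] one[of "1 - l"] assms mult_right_mono[of 1 "l powr (1 - p)" "\<bar>a\<bar> powr p"]
        mult_right_mono[of 1 "(1 - l) powr (1 - p)" "\<bar>b\<bar> powr p"] by auto
  next
    case False
    have "((1 - (1 - l)) *\<^sub>R (\<bar>a\<bar> / l) + (1 - l) *\<^sub>R (\<bar>b\<bar> / (1 - l))) powr p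
        \<le> (1 - (1 - l)) * (\<bar>a\<bar> / l) powr p + (1 - l) * (\<bar>b\<bar> / (1 - l)) powr p"
      by (rule convex_onD[OF powr_convex[OF assms(1)]]) (use assms False in auto)
    then show ?thesis using assms by (simp add: scale)
  qed
  finally show ?thesis .
qed

lemma dyadic_scale:
  fixes t :: real
  assumes "0 < t" "t \<le> 1 / 2 ^ n0"
  obtains n where "n0 \<le> n" "t \<le> 1 / 2 ^ n" "1 / 2 ^ n < 2 * t"
proof -
  define A where "A = {n. t \<le> 1 / 2 ^ n}"
  have "n0 \<in> A" using assms by (simp add: A_def)
  obtain N where N: "(1 / 2) ^ N < t" using real_arch_pow_inv[of t "1 / 2"] assms by auto
  have "n \<le> N" if "n \<in> A" for n
  proof (rule ccontr)
    assume "\<not> n \<le> N"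
    then have "(1 / 2 :: real) ^ n \<le> (1 / 2) ^ N" by (intro power_decreasing) auto
    then show False using that N by (simp add: A_def power_divide)
  qed
  then have fin: "finite A" by (meson finite_nat_set_iff_bounded_le)
  define n where "n = Max A"
  have "n \<in> A" unfolding n_def using \<open>n0 \<in> A\<close> fin by (intro Max_in) auto
  moreover have "n0 \<le> n" unfolding n_def using \<open>n0 \<in> A\<close> fin by simp
  moreover have "Suc n \<notin> A" using Max_ge[OF fin, of "Suc n"] by (auto simp: n_def)
  ultimately show thesis using that by (auto simp: A_def field_simps)
qed

lemma powr_scale_dyadic: "(2 powr (H * p)) ^ j * (2 powr (- H * p)) ^ j = 1" for H :: real
  by (simp flip: power_mult_distrib powr_add)

lemma le_dyadic_if_scaled_le:
  fixes x M H :: real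
  assumes "(2 powr (H * p)) ^ j * x \<le> M"
  shows "x \<le> M * (2 powr (- H * p)) ^ j"
proof -
  have "x = (2 powr (H * p)) ^ j * x * (2 powr (- H * p)) ^ j"
    using powr_scale_dyadic[of H p j] by (metis mult.commute mult.left_commute mult_1)
  also have "\<dots> \<le> M * (2 powr (- H * p)) ^ j"
    by (rule mult_right_mono[OF assms]) simp
  finally show ?thesis .
qed

lemma powr_dyadic: "(1 / 2 ^ j) powr H = (2 powr - H) ^ j" for H :: real
  by (simp add: powr_divide powr_power powr_minus_divide mult_ac flip: powr_realpow)
     (simp add: powr_powr mult_ac)

section \<open>Reduction to dyadic steps for a fixed continuous function\<close>

context
  fixes f :: "real \<Rightarrow> real" and p :: real
  assumes cont: "continuous_on {0..1} f" and p: "1 \<le> p"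
begin

lemma continuous_on_incr:
  assumes "0 \<le> h" "h \<le> s"
  shows "continuous_on {0..1 - s} (\<lambda>x. \<bar>f (x + h) - f x\<bar> powr p)"
proof -
  have "continuous_on {0..1 - s} (\<lambda>x. f (x + h))"
    by (rule continuous_on_compose2[OF cont]) (use assms in \<open>auto intro!: continuous_intros\<close>)
  moreover have "continuous_on {0..1 - s} f"
    by (rule continuous_on_subset[OF cont]) (use assms in auto)
  ultimately show ?thesis
    using p by (intro continuous_on_powr' continuous_intros) auto
qed

lemma set_integrable_incr:
  assumes "0 \<le> h" "h \<le> s"
  shows "set_integrable lborel {0..1 - s} (\<lambda>x. \<bar>f (x + h) - f x\<bar> powr p)"
  by (rule borel_integrable_atLeastAtMost'[OF continuous_on_incr[OF assms]])

lemma Lp_incr_nonneg: "0 \<le> Lp_incr p f h"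
  unfolding Lp_incr_def set_lebesgue_integral_def by (intro Bochner_Integration.integral_nonneg) simp

lemma Lp_incr_eq_0: "1 \<le> h \<Longrightarrow> Lp_incr p f h = 0"
  unfolding Lp_incr_def set_lebesgue_integral_def
  \<comment> \<open>For \<open>h = 1\<close> the interval is the single point 0, hence the
    exceptional null set.\<close>
  by (rule integral_eq_zero_AE, rule AE_mp[OF AE_lborel_singleton[of 0]])
     (auto simp: indicator_def)

lemma Lp_fun_continuous: "f \<in> Lp_fun p {0..1}"
proof -
  have 1: "set_integrable lborel {0..1} f"
    by (rule borel_integrable_atLeastAtMost'[OF cont])
  have "continuous_on {0..1} (\<lambda>x. \<bar>f x\<bar> powr p)"
    using p cont by (intro continuous_on_powr' continuous_intros) auto
  then have 2: "set_integrable lborel {0..1} (\<lambda>x. \<bar>f x\<bar> powr p)"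
    by (rule borel_integrable_atLeastAtMost')
  show ?thesis
    using 1 2 unfolding Lp_fun_def set_integrable_def set_borel_measurable_def
    by (auto simp: integrable_completion intro!: measurable_completion)
qed

text \<open>A negative step is a positive one seen from the other endpoint: translating by
  \<open>\<bar>s\<bar>\<close> carries one integral into the other, so only steps
  \<open>h \<ge> 0\<close> need study.\<close>

lemma modulus_integral_eq_Lp_incr:
  assumes "\<bar>s\<bar> \<le> 1"
  shows "set_lebesgue_integral lebesgue {x\<in>{0..1}. x + s \<in> {0..1}} (\<lambda>x. \<bar>f (x + s) - f x\<bar> powr p)
    = Lp_incr p f \<bar>s\<bar>"
proof (cases "s \<ge> 0")
  case True
  then have "{x\<in>{0..1}. x + s \<in> {0..1}} = {0..1 - s}" by auto
  then show ?thesis using True assms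
    by (simp add: set_integral_lebesgue_eq_lborel set_integrable_incr Lp_incr_def)
next
  case False
  define t where "t = - s"
  have t: "t > 0" "s = - t" using False by (auto simp: t_def)
  then have eq: "{x\<in>{0..1}. x + s \<in> {0..1}} = {t..1}" by auto
  have "continuous_on {t..1} (\<lambda>x. f (x - t))" "continuous_on {t..1} f"
    by (rule continuous_on_compose2[OF cont] continuous_on_subset[OF cont];
        use t in \<open>auto intro!: continuous_intros\<close>)+
  then have "continuous_on {t..1} (\<lambda>x. \<bar>f (x - t) - f x\<bar> powr p)"
    using p by (intro continuous_on_powr' continuous_intros) auto
  then have "set_integrable lborel {t..1} (\<lambda>x. \<bar>f (x - t) - f x\<bar> powr p)"
    by (rule borel_integrable_atLeastAtMost')
  then have "set_lebesgue_integral lebesgue {t..1} (\<lambda>x. \<bar>f (x - t) - f x\<bar> powr p)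
     = (LBINT x:{t..1}. \<bar>f (x - t) - f x\<bar> powr p)"
    by (rule set_integral_lebesgue_eq_lborel)
  also have "\<dots> = Lp_incr p f t"
    unfolding Lp_incr_def set_lebesgue_integral_def
    by (subst lborel_integral_real_affine[of 1 _ t])
       (auto intro!: Bochner_Integration.integral_cong simp: indicator_def abs_minus_commute add.commute)
  finally show ?thesis unfolding eq using t by simp
qed

lemma bounded_incr:
  obtains C where "C \<ge> 0" "\<And>x y. x \<in> {0..1} \<Longrightarrow> y \<in> {0..1} \<Longrightarrow> \<bar>f x - f y\<bar> powr p \<le> C"
proof -
  have "bounded (f ` {0..1})"
    by (intro compact_imp_bounded compact_continuous_image cont) auto
  then obtain D where "\<forall>y\<in>f ` {0..1}. norm y \<le> D"
    unfolding bounded_iff by blast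
  then have D: "\<And>x. x \<in> {0..1} \<Longrightarrow> \<bar>f x\<bar> \<le> D" by simp
  have "\<bar>f x - f y\<bar> powr p \<le> (2 * D) powr p" if "x \<in> {0..1}" "y \<in> {0..1}" for x y
    using D[OF that(1)] D[OF that(2)] p by (intro powr_mono2) auto
  then show thesis using that[of "(2 * D) powr p"] by auto
qed

text \<open>A real-valued supremum is meaningful only over a set bounded above; this licenses every
  later use of the supremum in \<open>Lp_modulus\<close>.\<close>

lemma bdd_above_Lp_incr: "bdd_above ((\<lambda>s. Lp_incr p f \<bar>s\<bar> powr (1 / p)) ` S)"
proof -
  obtain C where C: "C \<ge> 0" "\<And>x y. x \<in> {0..1} \<Longrightarrow> y \<in> {0..1} \<Longrightarrow> \<bar>f x - f y\<bar> powr p \<le> C"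
    using bounded_incr by blast
  have "Lp_incr p f h \<le> C" if "h \<ge> 0" for h
  proof (cases "h \<le> 1")
    case True
    have "Lp_incr p f h \<le> (LBINT x:{0..1 - h}. C)"
      unfolding Lp_incr_def
      by (rule set_integral_mono)
         (use that True C set_integrable_incr[of h h] in \<open>auto simp: set_integrable_def\<close>)
    also have "\<dots> \<le> C" using that True C by (simp add: set_integral_const mult_left_le_one_le)
    finally show ?thesis .
  qed (use C Lp_incr_eq_0 in simp)
  then show ?thesis using p
    by (intro bdd_aboveI2[of _ _ "C powr (1 / p)"] powr_mono2 Lp_incr_nonneg) auto
qed

lemma Lp_modulus_eq:
  assumes "t \<le> 1"
  shows "Lp_modulus p {0..1} f t = (SUP s\<in>{s. \<bar>s\<bar> \<le> t}. Lp_incr p f \<bar>s\<bar> powr (1 / p))"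
  unfolding Lp_modulus_def
  by (intro SUP_cong refl arg_cong2[of _ _ _ _ "(powr)"] modulus_integral_eq_Lp_incr) (use assms in auto)

lemma Lp_incr_le_modulus:
  assumes "0 \<le> t" "t \<le> 1"
  shows "Lp_incr p f t powr (1 / p) \<le> Lp_modulus p {0..1} f t"
  unfolding Lp_modulus_eq[OF assms(2)]
  by (rule cSUP_upper2[where x = t]) (use assms bdd_above_Lp_incr in auto)

lemma Lp_modulus_le:
  assumes "0 \<le> t" "t \<le> 1" "\<And>s. 0 \<le> s \<Longrightarrow> s \<le> t \<Longrightarrow> Lp_incr p f s \<le> c"
  shows "Lp_modulus p {0..1} f t \<le> c powr (1 / p)"
  unfolding Lp_modulus_eq[OF assms(2)]
  by (rule cSUP_least) (use assms p in \<open>auto intro!: powr_mono2 Lp_incr_nonneg exI[of _ 0]\<close>)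

text \<open>The increment over \<open>s + t\<close> is split at \<open>x + s\<close>. The second
  piece is an integral of increments over \<open>t\<close> with starting points in
  \<open>{s..1 - t}\<close>, a part of the full range \<open>{0..1 - t}\<close>.\<close>

lemma Lp_incr_add_le:
  assumes s: "0 \<le> s" "0 \<le> t" "s + t \<le> 1" and l: "0 < l" "l < 1"
  shows "Lp_incr p f (s + t) \<le> l powr (1 - p) * Lp_incr p f s + (1 - l) powr (1 - p) * Lp_incr p f t"
proof -
  let ?I = "\<lambda>h x. indicator {0..1 - h} x *\<^sub>R \<bar>f (x + h) - f x\<bar> powr p"
  have i: "integrable lborel (?I h)" if "0 \<le> h" for h
    using set_integrable_incr[of h h] that by (simp add: set_integrable_def)
  have shift: "Lp_incr p f t = (\<integral>x. ?I t (s + x) \<partial>lborel)" "integrable lborel (\<lambda>x. ?I t (s + x))"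
    using lborel_integral_real_affine[of 1 "?I t" s] lborel_integrable_real_affine[OF i[OF s(2)], of 1 s]
    by (simp_all add: Lp_incr_def set_lebesgue_integral_def)
  have "Lp_incr p f (s + t) \<le> (\<integral>x. l powr (1 - p) * ?I s x + (1 - l) powr (1 - p) * ?I t (s + x) \<partial>lborel)"
    unfolding Lp_incr_def set_lebesgue_integral_def
  proof (rule integral_mono)
    show "integrable lborel (\<lambda>x. l powr (1 - p) * ?I s x + (1 - l) powr (1 - p) * ?I t (s + x))"
      using i[OF s(1)] shift(2) by (intro Bochner_Integration.integrable_add integrable_mult_right) auto
    fix x
    show "?I (s + t) x \<le> l powr (1 - p) * ?I s x + (1 - l) powr (1 - p) * ?I t (s + x)"
      using powr_convex_combination_le[OF p l, of "f (x + s) - f x" "f (x + s + t) - f (x + s)"] s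
      by (auto simp: indicator_def add_ac intro: add_nonneg_nonneg)
  qed (use i s in simp)
  also have "\<dots> = l powr (1 - p) * Lp_incr p f s + (1 - l) powr (1 - p) * Lp_incr p f t"
    using i[OF s(1)] shift by (simp add: Lp_incr_def set_lebesgue_integral_def)
  finally show ?thesis .
qed

text \<open>The convexity weight \<open>q = 2 powr - H\<close> is chosen such that
  \<open>q powr (1 - p) * 2 powr (- H * p) = q < 1\<close>, so each halving step contracts the constant.\<close>

lemma Lp_incr_dyadic_le:
  fixes k :: nat
  assumes H: "0 < H" and M: "0 \<le> M"
    and le: "\<And>j. j \<ge> n0 \<Longrightarrow> Lp_incr p f (1 / 2 ^ j) \<le> M * (2 powr (- H * p)) ^ j"
    and "n0 \<le> n" "k \<le> 2 ^ N"
  shows "Lp_incr p f (k / 2 ^ (n + N)) \<le>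
    (1 + (1 - 2 powr - H) powr (1 - p)) / (1 - 2 powr - H) * M * (2 powr (- H * p)) ^ n"
  using assms(4,5)
proof (induction N arbitrary: n k)
  case 0
  define q :: real where "q = 2 powr - H"
  define w :: real where "w = 2 powr (- H * p)"
  have q: "0 < q" "q < 1" using H by (auto simp: q_def powr_less_one)
  have "1 * (M * w ^ n) \<le> (1 + (1 - q) powr (1 - p)) / (1 - q) * (M * w ^ n)"
    by (intro mult_right_mono) (use q M in \<open>auto simp: w_def field_simps intro: add_nonneg_nonneg\<close>)
  moreover have "Lp_incr p f (k / 2 ^ n) \<le> M * w ^ n"
  proof (cases "k = 0")
    case True
    then show ?thesis using M p by (simp add: Lp_incr_def w_def)
  next
    case False
    with 0 have "k = 1" by simp
    with 0 le[of n] show ?thesis by (simp add: w_def)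
  qed
  ultimately show ?case by (simp add: q_def w_def mult.assoc)
next
  case (Suc N)
  define q :: real where "q = 2 powr - H"
  define w :: real where "w = 2 powr (- H * p)"
  \<comment> \<open>\<open>K\<close> solves \<open>K = 1 + (1 - q) powr (1 - p) + q * K\<close>, so
    it is reproduced by the recursion below; the summand 1 keeps it at least 1, as the case
    \<open>N = 0\<close> requires.\<close>
  define K where "K = (1 + (1 - q) powr (1 - p)) / (1 - q)"
  have q: "0 < q" "q < 1" using H by (auto simp: q_def powr_less_one)
  have w: "0 < w" "w \<le> 1" using powr_less_one[of 2 "- H * p"] H p by (auto simp: w_def)
  have K: "K \<ge> 0" using q by (auto simp: K_def)
  have qw: "q powr (1 - p) * w = q"
    by (simp add: q_def w_def powr_powr flip: powr_add) (simp add: algebra_simps)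
  have Kq: "(1 - q) powr (1 - p) + q * K \<le> K"
  proof -
    have "K * (1 - q) = 1 + (1 - q) powr (1 - p)" using q by (simp add: K_def)
    then show ?thesis by (simp add: algebra_simps)
  qed
  show ?case
  proof (cases "k \<le> 2 ^ N")
    case True
    \<comment> \<open>The top binary digit is absent: the same fraction is read at level
      \<open>n + 1\<close>, where the induction hypothesis is even stronger.\<close>
    have "Lp_incr p f (k / 2 ^ (Suc n + N)) \<le> K * M * w ^ Suc n"
      using Suc.IH[of "Suc n" k] Suc.prems True by (simp add: K_def q_def w_def)
    also have "\<dots> \<le> K * M * w ^ n"
      using w K M by (intro mult_left_mono power_decreasing) auto
    finally show ?thesis by (simp add: K_def q_def w_def)
  next
    case False
    \<comment> \<open>The top binary digit is split off: a step \<open>1 / 2 ^ Suc n\<close>,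
      covered by the assumption \<open>le\<close> and given weight \<open>1 - q\<close>, plus a
      remainder covered by the induction hypothesis at level \<open>n + 1\<close> and given weight
      \<open>q\<close>.\<close>
    then obtain k' where k': "k = 2 ^ N + k'" using nat_le_iff_add[of "2 ^ N" k] by auto
    have k'le: "k' \<le> 2 ^ N" using k' Suc.prems by simp
    have k2: "real k \<le> 2 ^ Suc N" using Suc.prems(2) by (metis of_nat_le_iff of_nat_numeral of_nat_power)
    have e: "real k / 2 ^ (n + Suc N) = 1 / 2 ^ Suc n + k' / 2 ^ (Suc n + N)"
      by (simp add: k' power_add field_simps)
    have le1: "real k / 2 ^ (n + Suc N) \<le> 1"
    proof -
      have "(2::real) ^ Suc N \<le> 2 ^ (n + Suc N)" by (rule power_increasing) auto
      with k2 have "real k \<le> 2 ^ (n + Suc N)" by (rule order_trans)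
      then show ?thesis by (simp add: divide_le_eq)
    qed
    have "Lp_incr p f (k / 2 ^ (n + Suc N)) \<le> (1 - q) powr (1 - p) * Lp_incr p f (1 / 2 ^ Suc n)
        + (1 - (1 - q)) powr (1 - p) * Lp_incr p f (k' / 2 ^ (Suc n + N))"
      unfolding e by (rule Lp_incr_add_le) (use le1[unfolded e] q in auto)
    also have "\<dots> \<le> (1 - q) powr (1 - p) * (M * w ^ Suc n) + q powr (1 - p) * (K * M * w ^ Suc n)"
    proof -
      have "Lp_incr p f (1 / 2 ^ Suc n) \<le> M * w ^ Suc n"
        unfolding w_def by (rule le) (use Suc.prems in simp)
      moreover have "Lp_incr p f (k' / 2 ^ (Suc n + N)) \<le> K * M * w ^ Suc n"
        unfolding K_def q_def w_def by (rule Suc.IH) (use Suc.prems k'le in auto)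
      moreover have "1 - (1 - q) = q" by simp
      ultimately show ?thesis by (metis add_mono mult_left_mono powr_ge_zero)
    qed
    also have "\<dots> = ((1 - q) powr (1 - p) * w + (q powr (1 - p) * w) * K) * (M * w ^ n)"
      by (simp add: algebra_simps)
    also have "\<dots> \<le> K * (M * w ^ n)"
    proof (rule mult_right_mono)
      have "(1 - q) powr (1 - p) * w \<le> (1 - q) powr (1 - p)"
        using w by (simp add: mult_left_le)
      with Kq qw show "(1 - q) powr (1 - p) * w + (q powr (1 - p) * w) * K \<le> K" by simp
    qed (use M w in auto)
    finally show ?thesis by (simp add: K_def q_def w_def mult.assoc)
  qed
qed

text \<open>The constant of the dyadic bound does not depend on the depth \<open>N\<close>, so the
  bound passes to arbitrary steps by approximation and dominated convergence.\<close>

lemma Lp_incr_le: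
  assumes H: "0 < H" and M: "0 \<le> M"
    and le: "\<And>j. j \<ge> n \<Longrightarrow> Lp_incr p f (1 / 2 ^ j) \<le> M * (2 powr (- H * p)) ^ j"
    and s: "0 \<le> s" "s \<le> 1 / 2 ^ n"
  shows "Lp_incr p f s \<le>
    (1 + (1 - 2 powr - H) powr (1 - p)) / (1 - 2 powr - H) * M * (2 powr (- H * p)) ^ n" (is "_ \<le> ?R")
proof -
  \<comment> \<open>Rounding down keeps \<open>d N \<le> s\<close>: all integrands then live on the
    fixed interval \<open>{0..1 - s}\<close>, which is contained in \<open>{0..1 - d N}\<close>, and
    no argument leaves the unit interval.\<close>
  define k where "k N = nat \<lfloor>s * 2 ^ (n + N)\<rfloor>" for N
  define d where "d N = real (k N) / 2 ^ (n + N)" for N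
  have kle: "k N \<le> 2 ^ N" for N
  proof -
    have "s * 2 ^ (n + N) \<le> 2 ^ N" using mult_right_mono[OF s(2), of "2 ^ (n + N)"] by (simp add: power_add)
    then have "\<lfloor>s * 2 ^ (n + N)\<rfloor> \<le> 2 ^ N" by (metis floor_mono floor_of_int of_int_numeral of_int_power)
    then show ?thesis by (simp add: k_def nat_le_iff)
  qed
  have rk: "real (k N) = of_int \<lfloor>s * 2 ^ (n + N)\<rfloor>" for N using s by (simp add: k_def)
  have d: "0 \<le> d N" "d N \<le> s" "s - 1 / 2 ^ N \<le> d N" for N
  proof -
    show "0 \<le> d N" by (simp add: d_def)
    show "d N \<le> s" unfolding d_def rk by (simp add: divide_le_eq)
    have "s - 1 / 2 ^ (n + N) \<le> d N"
      using divide_right_mono[of "s * 2 ^ (n + N) - 1" "of_int \<lfloor>s * 2 ^ (n + N)\<rfloor>" "2 ^ (n + N)"]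
        floor_correct[of "s * 2 ^ (n + N)"] unfolding d_def rk by (simp add: diff_divide_distrib)
    moreover have "1 / 2 ^ (n + N) \<le> (1::real) / 2 ^ N" by (simp add: power_add field_simps)
    ultimately show "s - 1 / 2 ^ N \<le> d N" by linarith
  qed
  have s1: "s \<le> 1" using s(2) by (rule order_trans) simp
  have dlim: "d \<longlonglongrightarrow> s"
  proof (rule tendsto_sandwich)
    have "(\<lambda>N. s - (1 / 2) ^ N) \<longlonglongrightarrow> s - 0"
      by (intro tendsto_intros LIMSEQ_realpow_zero) auto
    then show "(\<lambda>N. s - 1 / 2 ^ N) \<longlonglongrightarrow> s" by (simp add: power_divide)
    show "(\<lambda>N. s) \<longlonglongrightarrow> s" by simp
  qed (use d in auto)
  obtain C where C: "C \<ge> 0" "\<And>x y. x \<in> {0..1} \<Longrightarrow> y \<in> {0..1} \<Longrightarrow> \<bar>f x - f y\<bar> powr p \<le> C"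
    using bounded_incr by blast
  let ?F = "\<lambda>h x. indicator {0..1 - s} x *\<^sub>R \<bar>f (x + h) - f x\<bar> powr p"
  have i: "integrable lborel (?F h)" if "0 \<le> h" "h \<le> s" for h
    using set_integrable_incr[OF that] by (simp add: set_integrable_def)
  have "(\<lambda>N. \<integral>x. ?F (d N) x \<partial>lborel) \<longlonglongrightarrow> (\<integral>x. ?F s x \<partial>lborel)"
  proof (rule integral_dominated_convergence[where w = "\<lambda>x. indicator {0..1 - s} x *\<^sub>R C"])
    show "AE x in lborel. (\<lambda>N. ?F (d N) x) \<longlonglongrightarrow> ?F s x"
    proof (rule AE_I2)
      fix x
      show "(\<lambda>N. ?F (d N) x) \<longlonglongrightarrow> ?F s x"
      proof (cases "x \<in> {0..1 - s}")
        case True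
        have "(\<lambda>N. f (x + d N)) \<longlonglongrightarrow> f (x + s)"
        proof (rule continuous_on_tendsto_compose[OF cont])
          show "(\<lambda>N. x + d N) \<longlonglongrightarrow> x + s" by (intro tendsto_intros dlim)
          show "\<forall>\<^sub>F N in sequentially. x + d N \<in> {0..1}"
          proof (rule always_eventually, rule allI)
            show "x + d N \<in> {0..1}" for N using True d[of N] by auto
          qed
        qed (use True s in auto)
        then have "(\<lambda>N. \<bar>f (x + d N) - f x\<bar> powr p) \<longlonglongrightarrow> \<bar>f (x + s) - f x\<bar> powr p"
          using p by (intro tendsto_powr2 tendsto_intros) auto
        then show ?thesis by (intro tendsto_scaleR tendsto_const)
      qed simp
    qed
    show "AE x in lborel. norm (?F (d N) x) \<le> indicator {0..1 - s} x *\<^sub>R C" for N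
    proof (rule AE_I2)
      fix x show "norm (?F (d N) x) \<le> indicator {0..1 - s} x *\<^sub>R C"
        using C d[of N] s by (auto simp: indicator_def)
    qed
    show "?F (d N) \<in> borel_measurable lborel" for N using i[of "d N"] d by blast
    show "?F s \<in> borel_measurable lborel" using i[of s] s by blast
    show "integrable lborel (\<lambda>x. indicator {0..1 - s} x *\<^sub>R C)"
      by (intro integrable_scaleR_left integrable_real_indicator) (auto simp: emeasure_lborel_Icc_eq)
  qed
  moreover have "(\<integral>x. ?F (d N) x \<partial>lborel) \<le> ?R" for N
  proof -
    have "(\<integral>x. ?F (d N) x \<partial>lborel) \<le> Lp_incr p f (d N)"
      unfolding Lp_incr_def set_lebesgue_integral_def
    proof (rule integral_mono)
      show "integrable lborel (\<lambda>x. indicator {0..1 - d N} x *\<^sub>R \<bar>f (x + d N) - f x\<bar> powr p)"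
        using set_integrable_incr[of "d N" "d N"] d by (simp add: set_integrable_def)
      show "?F (d N) x \<le> indicator {0..1 - d N} x *\<^sub>R \<bar>f (x + d N) - f x\<bar> powr p" for x
        using d[of N] by (auto simp: indicator_def)
    qed (use i d in simp)
    also have "\<dots> \<le> ?R"
      unfolding d_def by (rule Lp_incr_dyadic_le[OF H M le order_refl kle]) 
    finally show ?thesis .
  qed
  ultimately have "(\<integral>x. ?F s x \<partial>lborel) \<le> ?R" by (intro LIMSEQ_le_const2) auto
  then show ?thesis by (simp add: Lp_incr_def set_lebesgue_integral_def)
qed

text \<open>\<open>K\<close> is chosen before \<open>M\<close>, \<open>n\<close> and
  \<open>t\<close>. This uniformity lets one statement serve both spaces: a fixed \<open>M\<close>
  from level 0 on for \<open>Bes\<close>, an arbitrarily small \<open>M\<close> from some level on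
  for \<open>bes\<close>. The factor \<open>2 powr (H * p)\<close> in \<open>K\<close> pays for
  replacing \<open>t\<close> by a dyadic number below \<open>2 * t\<close>.\<close>

lemma Lp_modulus_le_dyadic:
  assumes H: "0 < H"
  obtains K where "K > 0" and "\<And>M n t. \<lbrakk>0 \<le> M;
      \<And>j. j \<ge> n \<Longrightarrow> Lp_incr p f (1 / 2 ^ j) \<le> M * (2 powr (- H * p)) ^ j; 0 < t; t \<le> 1 / 2 ^ n\<rbrakk>
      \<Longrightarrow> Lp_modulus p {0..1} f t \<le> (K * M) powr (1 / p) * t powr H"
proof -
  define K0 where "K0 = (1 + (1 - 2 powr - H) powr (1 - p)) / (1 - 2 powr - H)"
  define K where "K = K0 * 2 powr (H * p)"
  have q: "2 powr - H < (1::real)" using H by (simp add: powr_less_one)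
  then have "K0 > 0" by (auto simp: K0_def intro!: divide_pos_pos add_pos_nonneg)
  then have "K > 0" by (simp add: K_def)
  moreover have "Lp_modulus p {0..1} f t \<le> (K * M) powr (1 / p) * t powr H"
    if M: "0 \<le> M" and le: "\<And>j. j \<ge> n \<Longrightarrow> Lp_incr p f (1 / 2 ^ j) \<le> M * (2 powr (- H * p)) ^ j"
      and t: "0 < t" "t \<le> 1 / 2 ^ n" for M n t
  proof -
    obtain m where m: "n \<le> m" "t \<le> 1 / 2 ^ m" "1 / 2 ^ m < 2 * t"
      using dyadic_scale[OF t] by blast
    have t1: "t \<le> 1" using m(2) by (rule order_trans) simp
    have "(2 powr (- H * p)) ^ m = (1 / 2 ^ m) powr (H * p)"
      by (simp add: powr_power powr_divide powr_minus_divide mult_ac flip: powr_realpow powr_powr)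
         (simp add: powr_powr mult_ac)
    also have "\<dots> \<le> (2 * t) powr (H * p)" using m(3) H p by (intro powr_mono2) auto
    also have "\<dots> = 2 powr (H * p) * t powr (H * p)" using t by (simp add: powr_mult)
    finally have w: "(2 powr (- H * p)) ^ m \<le> 2 powr (H * p) * t powr (H * p)" .
    have "Lp_modulus p {0..1} f t \<le> (K * M * t powr (H * p)) powr (1 / p)"
    proof (rule Lp_modulus_le)
      fix s assume s: "0 \<le> s" "s \<le> t"
      have "Lp_incr p f s \<le> K0 * M * (2 powr (- H * p)) ^ m"
        unfolding K0_def by (rule Lp_incr_le[OF H M]) (use le m s in auto)
      also have "\<dots> \<le> K0 * M * (2 powr (H * p) * t powr (H * p))"
        using w M \<open>K0 > 0\<close> by (intro mult_left_mono) auto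
      finally show "Lp_incr p f s \<le> K * M * t powr (H * p)" by (simp add: K_def mult_ac)
    qed (use t t1 in auto)
    also have "\<dots> = (K * M) powr (1 / p) * t powr H"
      using M \<open>K > 0\<close> p t by (simp add: powr_mult powr_powr)
    finally show ?thesis .
  qed
  ultimately show thesis using that by blast
qed

text \<open>The bound \<open>C\<close> is a natural number so that, for a random path, the criterion
  is a countable combination of measurable conditions.\<close>

lemma Bes_iff_dyadic:
  assumes H: "0 < H"
  shows "f \<in> Bes H p \<longleftrightarrow> (\<exists>C::nat. \<forall>j. (2 powr (H * p)) ^ j * Lp_incr p f (1 / 2 ^ j) \<le> C)"
proof
  assume "f \<in> Bes H p"
  define S where "S = (SUP t\<in>{0<..1}. ennreal (Lp_modulus p {0..1} f t / t powr H))"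
  have S: "S < \<infinity>" using \<open>f \<in> Bes H p\<close> by (auto simp: Bes_def besov_norm_def S_def)
  define C where "C = enn2real S"
  have C: "Lp_modulus p {0..1} f t \<le> C * t powr H" if "t \<in> {0<..1}" for t
  proof -
    have "ennreal (Lp_modulus p {0..1} f t / t powr H) \<le> S"
      unfolding S_def using that by (rule SUP_upper)
    then have "Lp_modulus p {0..1} f t / t powr H \<le> C"
      unfolding C_def using S by (metis enn2real_leI enn2real_nonneg ennreal_enn2real ennreal_le_iff infinity_ennreal_def)
    then show ?thesis using that by (simp add: field_simps)
  qed
  have "C \<ge> 0" by (simp add: C_def)
  have *: "(2 powr (H * p)) ^ j * Lp_incr p f (1 / 2 ^ j) \<le> C powr p" for j
  proof -
    have "Lp_incr p f (1 / 2 ^ j) powr (1 / p) \<le> C * (1 / 2 ^ j) powr H"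
      by (rule order_trans[OF Lp_incr_le_modulus C]) auto
    then have "(Lp_incr p f (1 / 2 ^ j) powr (1 / p)) powr p \<le> (C * (1 / 2 ^ j) powr H) powr p"
      using p by (intro powr_mono2) auto
    then have "Lp_incr p f (1 / 2 ^ j) \<le> C powr p * (2 powr (- H * p)) ^ j"
      using p \<open>C \<ge> 0\<close> Lp_incr_nonneg[of "1 / 2 ^ j"]
      by (simp add: powr_powr powr_mult powr_dyadic[of j "H * p"])
    then have "(2 powr (H * p)) ^ j * Lp_incr p f (1 / 2 ^ j)
        \<le> (2 powr (H * p)) ^ j * (C powr p * (2 powr (- H * p)) ^ j)"
      by (intro mult_left_mono) auto
    also have "\<dots> = C powr p" using powr_scale_dyadic[of H p j] by (simp add: mult_ac)
    finally show ?thesis .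
  qed
  obtain N :: nat where "C powr p \<le> N" using real_arch_simple by blast
  then show "\<exists>C::nat. \<forall>j. (2 powr (H * p)) ^ j * Lp_incr p f (1 / 2 ^ j) \<le> C"
    using * order_trans by blast
next
  assume "\<exists>C::nat. \<forall>j. (2 powr (H * p)) ^ j * Lp_incr p f (1 / 2 ^ j) \<le> C"
  then obtain C :: nat where C: "\<And>j. (2 powr (H * p)) ^ j * Lp_incr p f (1 / 2 ^ j) \<le> C" by blast
  obtain K where K: "K > 0" "\<And>M n t. \<lbrakk>0 \<le> M;
      \<And>j. j \<ge> n \<Longrightarrow> Lp_incr p f (1 / 2 ^ j) \<le> M * (2 powr (- H * p)) ^ j; 0 < t; t \<le> 1 / 2 ^ n\<rbrakk>
      \<Longrightarrow> Lp_modulus p {0..1} f t \<le> (K * M) powr (1 / p) * t powr H"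
    using Lp_modulus_le_dyadic[OF H] by blast
  have le: "Lp_incr p f (1 / 2 ^ j) \<le> C * (2 powr (- H * p)) ^ j" for j
    by (rule le_dyadic_if_scaled_le[OF C])
  have "ennreal (Lp_modulus p {0..1} f t / t powr H) \<le> ennreal ((K * C) powr (1 / p))"
    if "t \<in> {0<..1}" for t
    using K(2)[of C 0 t] le that by (intro ennreal_leI) (auto simp: field_simps)
  then have "(SUP t\<in>{0<..1}. ennreal (Lp_modulus p {0..1} f t / t powr H)) \<le> ennreal ((K * C) powr (1 / p))"
    by (rule SUP_least)
  then have "(SUP t\<in>{0<..1}. ennreal (Lp_modulus p {0..1} f t / t powr H)) < \<infinity>"
    by (rule order_le_less_trans) simp
  then show "f \<in> Bes H p"
    using Lp_fun_continuous by (simp add: Bes_def besov_norm_def)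
qed

lemma bes_iff_dyadic:
  assumes H: "0 < H"
  shows "f \<in> bes H p \<longleftrightarrow> (\<lambda>j. (2 powr (H * p)) ^ j * Lp_incr p f (1 / 2 ^ j)) \<longlonglongrightarrow> 0"
proof
  assume "f \<in> bes H p"
  then have o: "Lp_modulus p {0..1} f \<in> o[at_right 0](\<lambda>t. t powr H)" by (simp add: bes_def)
  show "(\<lambda>j. (2 powr (H * p)) ^ j * Lp_incr p f (1 / 2 ^ j)) \<longlonglongrightarrow> 0"
  proof (rule LIMSEQ_I)
    fix e :: real assume e: "e > 0"
    \<comment> \<open>Chosen so that \<open>c powr p = e / 2\<close>, strictly below
      \<open>e\<close>.\<close>
    define c where "c = (e / 2) powr (1 / p)"
    have "c > 0" using e by (simp add: c_def)
    have "\<forall>\<^sub>F t in at_right 0. norm (Lp_modulus p {0..1} f t) \<le> c * norm (t powr H)"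
      using landau_o.smallD[OF o \<open>c > 0\<close>] .
    moreover have "filterlim (\<lambda>j. 1 / 2 ^ j :: real) (at_right 0) sequentially"
    proof -
      have "(\<lambda>j. (1 / 2) ^ j :: real) \<longlonglongrightarrow> 0" by (intro LIMSEQ_realpow_zero) auto
      then show ?thesis
        by (auto simp: filterlim_at power_divide)
    qed
    ultimately have "\<forall>\<^sub>F j in sequentially.
        norm (Lp_modulus p {0..1} f (1 / 2 ^ j)) \<le> c * norm ((1 / 2 ^ j :: real) powr H)"
      by (rule eventually_compose_filterlim)
    then obtain n where n: "\<And>j. j \<ge> n \<Longrightarrow> \<bar>Lp_modulus p {0..1} f (1 / 2 ^ j)\<bar> \<le> c * (1 / 2 ^ j) powr H"
      by (auto simp: eventually_sequentially)
    have "norm ((2 powr (H * p)) ^ j * Lp_incr p f (1 / 2 ^ j) - 0) < e" if "j \<ge> n" for j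
    proof -
      have "Lp_incr p f (1 / 2 ^ j) powr (1 / p) \<le> c * (1 / 2 ^ j) powr H"
        using Lp_incr_le_modulus[of "1 / 2 ^ j"] n[OF that] by auto
      then have "(Lp_incr p f (1 / 2 ^ j) powr (1 / p)) powr p \<le> (c * (1 / 2 ^ j) powr H) powr p"
        using p by (intro powr_mono2) auto
      then have "Lp_incr p f (1 / 2 ^ j) \<le> (e / 2) * (2 powr (- H * p)) ^ j"
        using p e Lp_incr_nonneg[of "1 / 2 ^ j"]
        by (simp add: powr_powr powr_mult powr_dyadic[of j "H * p"] c_def)
      then have "(2 powr (H * p)) ^ j * Lp_incr p f (1 / 2 ^ j)
          \<le> (2 powr (H * p)) ^ j * ((e / 2) * (2 powr (- H * p)) ^ j)"
        by (intro mult_left_mono) auto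
      also have "\<dots> = e / 2" using powr_scale_dyadic[of H p j] by (simp add: mult_ac)
      also have "\<dots> < e" using e by simp
      finally show ?thesis using Lp_incr_nonneg[of "1 / 2 ^ j"] by simp
    qed
    then show "\<exists>n. \<forall>j\<ge>n. norm ((2 powr (H * p)) ^ j * Lp_incr p f (1 / 2 ^ j) - 0) < e" by blast
  qed
next
  assume lim: "(\<lambda>j. (2 powr (H * p)) ^ j * Lp_incr p f (1 / 2 ^ j)) \<longlonglongrightarrow> 0"
  obtain K where K: "K > 0" "\<And>M n t. \<lbrakk>0 \<le> M;
      \<And>j. j \<ge> n \<Longrightarrow> Lp_incr p f (1 / 2 ^ j) \<le> M * (2 powr (- H * p)) ^ j; 0 < t; t \<le> 1 / 2 ^ n\<rbrakk>
      \<Longrightarrow> Lp_modulus p {0..1} f t \<le> (K * M) powr (1 / p) * t powr H"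
    using Lp_modulus_le_dyadic[OF H] by blast
  have "Lp_modulus p {0..1} f \<in> o[at_right 0](\<lambda>t. t powr H)"
  proof (rule landau_o.smallI)
    fix c :: real assume c: "c > 0"
    \<comment> \<open>Solves \<open>(K * M) powr (1 / p) = c\<close>, so the uniform estimate yields
      exactly the constant \<open>c\<close>.\<close>
    define M where "M = c powr p / K"
    have M: "M > 0" "(K * M) powr (1 / p) = c" using c K(1) p by (auto simp: M_def powr_powr)
    from LIMSEQ_D[OF lim M(1)] obtain n where
      n: "\<And>j. j \<ge> n \<Longrightarrow> \<bar>(2 powr (H * p)) ^ j * Lp_incr p f (1 / 2 ^ j)\<bar> < M" by auto
    have le: "Lp_incr p f (1 / 2 ^ j) \<le> M * (2 powr (- H * p)) ^ j" if "j \<ge> n" for j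
    proof -
      have "(2 powr (H * p)) ^ j * Lp_incr p f (1 / 2 ^ j) \<le> M" using n[OF that] by simp
      then show ?thesis by (rule le_dyadic_if_scaled_le)
    qed
    have "norm (Lp_modulus p {0..1} f t) \<le> c * norm (t powr H)" if "0 < t" "t < 1 / 2 ^ n" for t
    proof -
      have "t \<le> 1" using that(2) order_less_le_trans[of t "1 / 2 ^ n" 1] by simp
      then have "0 \<le> Lp_modulus p {0..1} f t"
        using Lp_incr_le_modulus[of t] that(1) by (auto intro: order_trans[rotated])
      moreover have "Lp_modulus p {0..1} f t \<le> (K * M) powr (1 / p) * t powr H"
        by (rule K(2)[OF less_imp_le[OF M(1)] le]) (use that in auto)
      ultimately show ?thesis by (simp add: M(2))
    qed
    then show "\<forall>\<^sub>F t in at_right 0. norm (Lp_modulus p {0..1} f t) \<le> c * norm (t powr H)"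
      by (auto simp: eventually_at_right_field intro!: exI[of _ "1 / 2 ^ n"])
  qed
  then show "f \<in> bes H p" using Lp_fun_continuous by (simp add: bes_def)
qed

end

subsection \<open>Even moments of Gaussian pairs\<close>

text \<open>The factor is the double factorial \<open>(2 * k - 1)!!\<close>. Degenerate variables
  have to be covered too: there the centred constant is 0, and the formula survives for
  \<open>k = 0\<close> because \<open>0 ^ 0 = 1\<close>.\<close>

lemma gaussian_rv_centred_moments:
  assumes "prob_space M" and g: "gaussian_rv M Y" and m0: "(\<integral>\<omega>. Y \<omega> \<partial>M) = 0"
  shows integrable_power_gaussian_rv: "integrable M (\<lambda>\<omega>. Y \<omega> ^ n)"
    and even_moment_gaussian_rv:
      "(\<integral>\<omega>. Y \<omega> ^ (2 * k) \<partial>M) = fact (2 * k) / (2 ^ k * fact k) * (\<integral>\<omega>. (Y \<omega>)\<^sup>2 \<partial>M) ^ k"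
proof -
  interpret prob_space M by fact
  have [measurable]: "Y \<in> borel_measurable M" using g by (simp add: gaussian_rv_def)
  consider (const) m where "AE \<omega> in M. Y \<omega> = m"
    | (normal) m \<sigma> where "\<sigma> > 0" "distributed M lborel Y (\<lambda>x. ennreal (normal_density m \<sigma> x))"
    using g by (auto simp: gaussian_rv_def)
  then have "integrable M (\<lambda>\<omega>. Y \<omega> ^ n) \<and>
      (\<integral>\<omega>. Y \<omega> ^ (2 * k) \<partial>M) = fact (2 * k) / (2 ^ k * fact k) * (\<integral>\<omega>. (Y \<omega>)\<^sup>2 \<partial>M) ^ k"
  proof cases
    case const
    have "(\<integral>\<omega>. Y \<omega> \<partial>M) = (\<integral>\<omega>. m \<partial>M)"
      using const by (intro integral_cong_AE) auto
    then have "m = 0" using m0 by (simp add: prob_space)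
    have pw: "integrable M (\<lambda>\<omega>. Y \<omega> ^ i) \<and> (\<integral>\<omega>. Y \<omega> ^ i \<partial>M) = 0 ^ i" for i
    proof -
      have ae: "AE \<omega> in M. Y \<omega> ^ i = 0 ^ i" using const by eventually_elim (simp add: \<open>m = 0\<close>)
      have "integrable M (\<lambda>\<omega>. Y \<omega> ^ i) \<longleftrightarrow> integrable M (\<lambda>\<omega>. 0 ^ i :: real)"
        by (rule integrable_cong_AE[OF _ _ ae]) auto
      moreover have "(\<integral>\<omega>. Y \<omega> ^ i \<partial>M) = (\<integral>\<omega>. (0 ^ i :: real) \<partial>M)"
        by (rule integral_cong_AE[OF _ _ ae]) auto
      ultimately show ?thesis by (simp add: prob_space)
    qed
    show ?thesis using pw[of n] pw[of "2 * k"] pw[of 2] by (cases k) auto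
  next
    case normal
    have "m = 0" using normal_distributed_expectation[OF normal] m0 by simp
    note D = normal(2)[unfolded \<open>m = 0\<close>]
    have i: "integrable M (\<lambda>\<omega>. Y \<omega> ^ i)" for i
      using distributed_integrable[OF D, of "\<lambda>x. x ^ i"] integrable_normal_moment[OF normal(1), of 0 i]
      by simp
    have e: "(\<integral>\<omega>. Y \<omega> ^ (2 * i) \<partial>M) = fact (2 * i) / ((2 / \<sigma>\<^sup>2) ^ i * fact i)" for i
      using distributed_integral[OF D, of "\<lambda>x. x ^ (2 * i)"] integral_normal_moment_even[OF normal(1), of 0 i]
      by simp
    have "(\<integral>\<omega>. (Y \<omega>)\<^sup>2 \<partial>M) = \<sigma>\<^sup>2" using e[of 1] normal(1) by simp
    then show ?thesis using i e[of k] by (simp add: power_divide)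
  qed
  then show "integrable M (\<lambda>\<omega>. Y \<omega> ^ n)"
    "(\<integral>\<omega>. Y \<omega> ^ (2 * k) \<partial>M) = fact (2 * k) / (2 ^ k * fact k) * (\<integral>\<omega>. (Y \<omega>)\<^sup>2 \<partial>M) ^ k"
    by auto
qed

text \<open>Method of majorants: coefficientwise domination is inherited by products, which produces
  constants independent of the parameters inside the polynomials.\<close>

lemma abs_coeff_mult_le:
  fixes p q P Q :: "real poly"
  assumes "\<And>k. \<bar>coeff p k\<bar> \<le> coeff P k" "\<And>k. \<bar>coeff q k\<bar> \<le> coeff Q k"
  shows "\<bar>coeff (p * q) k\<bar> \<le> coeff (P * Q) k"
proof -
  have "\<bar>coeff (p * q) k\<bar> \<le> (\<Sum>i\<le>k. \<bar>coeff p i * coeff q (k - i)\<bar>)"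
    unfolding coeff_mult by (rule sum_abs)
  also have "\<dots> \<le> (\<Sum>i\<le>k. coeff P i * coeff Q (k - i))"
    unfolding abs_mult
    by (intro sum_mono mult_mono assms) (use assms(1) abs_ge_zero order_trans in blast)+
  finally show ?thesis by (simp add: coeff_mult)
qed

lemma abs_coeff_power_le:
  fixes p P :: "real poly"
  assumes "\<And>k. \<bar>coeff p k\<bar> \<le> coeff P k"
  shows "\<bar>coeff (p ^ n) k\<bar> \<le> coeff (P ^ n) k"
proof (induction n arbitrary: k)
  case 0
  then show ?case by (simp add: coeff_1)
next
  case (Suc n)
  show ?case unfolding power_Suc by (rule abs_coeff_mult_le[OF assms Suc])
qed

text \<open>With \<open>a\<close>, \<open>b\<close> the variances and \<open>r\<close> the
  covariance of a pair, \<open>r = 0\<close> is the uncorrelated case. The difference of the two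
  powers contains the factor \<open>q - q0\<close>, which is \<open>2 * r\<close> times the
  variable; the cofactor is bounded uniformly by majorants.\<close>

lemma coeff_quadratic_power_perturbation:
  fixes n k :: nat
  obtains C :: real where "C \<ge> 0"
    and "\<And>a b r. \<lbrakk>\<bar>a\<bar> \<le> 2; \<bar>b\<bar> \<le> 2; \<bar>r\<bar> \<le> 2\<rbrakk> \<Longrightarrow>
           \<bar>coeff ([:a, 2 * r, b:] ^ n) k - coeff ([:a, 0, b:] ^ n) k\<bar> \<le> C * \<bar>r\<bar>"
proof -
  \<comment> \<open>Majorant of every admissible quadratic, since \<open>\<bar>a\<bar>\<close>,
    \<open>\<bar>r\<bar>\<close> and \<open>\<bar>b\<bar>\<close> are at most 2.\<close>
  define P where "P = [:2, 4, 2::real:]"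
  define C where "C = coeff ([:0, 2:] * (\<Sum>i<n. P ^ (n - Suc i) * P ^ i)) k"
  have C: "\<bar>coeff ([:a, 2 * r, b:] ^ n) k - coeff ([:a, 0, b:] ^ n) k\<bar> \<le> C * \<bar>r\<bar>"
    if "\<bar>a\<bar> \<le> 2" "\<bar>b\<bar> \<le> 2" "\<bar>r\<bar> \<le> 2" for a b r
  proof -
    define q where "q = [:a, 2 * r, b:]"
    define q0 where "q0 = [:a, 0, b:]"
    have q: "\<bar>coeff q k\<bar> \<le> coeff P k" "\<bar>coeff q0 k\<bar> \<le> coeff P k" for k
      using that by (auto simp: q_def q0_def P_def coeff_pCons split: nat.splits)
    have d: "q - q0 = smult r [:0, 2:]" by (simp add: q_def q0_def)
    have *: "q ^ n - q0 ^ n = smult r ([:0, 2:] * (\<Sum>i<n. q0 ^ (n - Suc i) * q ^ i))"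
      unfolding power_diff_sumr2[of q] d by (simp add: mult.commute)
    have s: "\<bar>coeff (\<Sum>i<n. q0 ^ (n - Suc i) * q ^ i) j\<bar> \<le> coeff (\<Sum>i<n. P ^ (n - Suc i) * P ^ i) j" for j
      unfolding coeff_sum
      by (rule order_trans[OF sum_abs])
        (intro sum_mono abs_coeff_mult_le abs_coeff_power_le q)
    have "\<bar>coeff ([:0, 2:] * (\<Sum>i<n. q0 ^ (n - Suc i) * q ^ i)) k\<bar> \<le> C"
      unfolding C_def by (rule abs_coeff_mult_le[OF _ s]) (simp add: coeff_pCons split: nat.splits)
    then have "\<bar>r\<bar> * \<bar>coeff ([:0, 2:] * (\<Sum>i<n. q0 ^ (n - Suc i) * q ^ i)) k\<bar> \<le> \<bar>r\<bar> * C"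
      by (intro mult_left_mono) auto
    moreover have "coeff (q ^ n) k - coeff (q0 ^ n) k =
        r * coeff ([:0, 2:] * (\<Sum>i<n. q0 ^ (n - Suc i) * q ^ i)) k"
      by (subst coeff_diff[symmetric], subst *, subst coeff_smult) (rule refl)
    ultimately show ?thesis unfolding q_def[symmetric] q0_def[symmetric]
      by (simp only: abs_mult mult.commute[of C])
  qed
  from C[of 0 0 1] have "C \<ge> 0" by simp
  then show thesis using that C by blast
qed

lemma coeff_even_quadratic_power:
  fixes a b :: real
  shows "coeff ([:a, 0, b:] ^ (2 * m)) (2 * m) = real ((2 * m) choose m) * a ^ m * b ^ m"
proof -
  have eq: "[:a, 0, b:] = monom b 2 + [:a:]" by (simp add: monom_altdef numeral_2_eq_2)
  have "coeff ([:a, 0, b:] ^ (2 * m)) (2 * m) =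
      (\<Sum>i\<le>2 * m. real ((2 * m) choose i) * (if i = m then b ^ i * a ^ (2 * m - i) else 0))"
    unfolding eq binomial_ring coeff_sum
    by (intro sum.cong refl)
       (auto simp: monom_power poly_const_pow of_nat_poly coeff_monom algebra_simps)
  also have "\<dots> = real ((2 * m) choose m) * (b ^ m * a ^ m)"
    by (subst sum.remove[of _ m]) auto
  finally show ?thesis by (simp add: mult_ac)
qed

text \<open>Reduces integrability of mixed moments to that of even moments of each variable
  separately.\<close>

lemma abs_power_mult_power_le:
  fixes u v :: real
  shows "\<bar>u ^ k * v ^ l\<bar> \<le> 1 + u ^ (2 * (k + l)) + v ^ (2 * (k + l))"
proof -
  have *: "\<bar>u ^ k * v ^ l\<bar> \<le> 1 + u ^ (2 * (k + l))" if "\<bar>v\<bar> \<le> \<bar>u\<bar>" for u v :: real and k l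
  proof -
    have "\<bar>u ^ k * v ^ l\<bar> \<le> \<bar>u\<bar> ^ k * \<bar>u\<bar> ^ l"
      unfolding abs_mult power_abs using that by (intro mult_left_mono power_mono) auto
    also have "\<dots> = \<bar>u ^ (k + l)\<bar>" by (simp add: power_add power_abs abs_mult)
    also have "\<dots> \<le> 1 + (u ^ (k + l))\<^sup>2" using zero_le_power2[of "\<bar>u ^ (k + l)\<bar> - 1"] by (simp add: power2_eq_square algebra_simps)
    finally show ?thesis by (simp add: power_mult[symmetric] mult.commute)
  qed
  have e: "0 \<le> u ^ (2 * (k + l))" "0 \<le> v ^ (2 * (k + l))" by (simp_all add: zero_le_even_power)
  show ?thesis
  proof (cases "\<bar>v\<bar> \<le> \<bar>u\<bar>")
    case True
    show ?thesis using *[OF True, of k l] e by simp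
  next
    case False
    then have "\<bar>u\<bar> \<le> \<bar>v\<bar>" by simp
    from *[OF this, of l k] e show ?thesis by (simp add: mult.commute add.commute)
  qed
qed

text \<open>Both sides of \<open>E (U + t * V) ^ (4 * m) = c * (E (U + t * V)\<^sup>2) ^ (2 * m)\<close> are polynomials in
  \<open>t\<close>; the bound comes from comparing the coefficients of \<open>t ^ (2 * m)\<close>.\<close>

lemma gaussian_pair_even_power_covariance:
  fixes m :: nat
  obtains C :: real where "C \<ge> 0"
    and "\<And>(M :: 'a measure) U V. \<lbrakk>prob_space M;
           \<And>a b. gaussian_rv M (\<lambda>\<omega>. a * U \<omega> + b * V \<omega>);
           (\<integral>\<omega>. U \<omega> \<partial>M) = 0; (\<integral>\<omega>. V \<omega> \<partial>M) = 0;
           (\<integral>\<omega>. (U \<omega>)\<^sup>2 \<partial>M) \<le> 2; (\<integral>\<omega>. (V \<omega>)\<^sup>2 \<partial>M) \<le> 2\<rbrakk> \<Longrightarrow>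
           \<bar>(\<integral>\<omega>. U \<omega> ^ (2 * m) * V \<omega> ^ (2 * m) \<partial>M) - (\<integral>\<omega>. U \<omega> ^ (2 * m) \<partial>M) * (\<integral>\<omega>. V \<omega> ^ (2 * m) \<partial>M)\<bar>
             \<le> C * \<bar>\<integral>\<omega>. U \<omega> * V \<omega> \<partial>M\<bar>"
proof -
  obtain C :: real where C: "C \<ge> 0" "\<And>a b r. \<lbrakk>\<bar>a\<bar> \<le> 2; \<bar>b\<bar> \<le> 2; \<bar>r\<bar> \<le> 2\<rbrakk> \<Longrightarrow>
      \<bar>coeff ([:a, 2 * r, b:] ^ (2 * m)) (2 * m) - coeff ([:a, 0, b:] ^ (2 * m)) (2 * m)\<bar> \<le> C * \<bar>r\<bar>"
    using coeff_quadratic_power_perturbation by blast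
  define c where "c k = fact (2 * k) / (2 ^ k * fact k :: real)" for k
  define D where "D = real ((4 * m) choose (2 * m))"
  have D: "D > 0" by (simp add: D_def)
  have "\<bar>(\<integral>\<omega>. U \<omega> ^ (2 * m) * V \<omega> ^ (2 * m) \<partial>M) - (\<integral>\<omega>. U \<omega> ^ (2 * m) \<partial>M) * (\<integral>\<omega>. V \<omega> ^ (2 * m) \<partial>M)\<bar>
       \<le> (c (2 * m) / D * C) * \<bar>\<integral>\<omega>. U \<omega> * V \<omega> \<partial>M\<bar>"
    if "prob_space M" and g: "\<And>a b. gaussian_rv M (\<lambda>\<omega>. a * U \<omega> + b * V \<omega>)"
      and z: "(\<integral>\<omega>. U \<omega> \<partial>M) = 0" "(\<integral>\<omega>. V \<omega> \<partial>M) = 0"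
      and s: "(\<integral>\<omega>. (U \<omega>)\<^sup>2 \<partial>M) \<le> 2" "(\<integral>\<omega>. (V \<omega>)\<^sup>2 \<partial>M) \<le> 2"
    for M :: "'a measure" and U V
  proof -
    interpret prob_space M by fact
    have gU: "gaussian_rv M U" and gV: "gaussian_rv M V"
      using g[of 1 0] g[of 0 1] by simp_all
    have [measurable]: "U \<in> borel_measurable M" "V \<in> borel_measurable M"
      using gU gV by (simp_all add: gaussian_rv_def)
    note iU = integrable_power_gaussian_rv[OF \<open>prob_space M\<close> gU z(1)]
    note iV = integrable_power_gaussian_rv[OF \<open>prob_space M\<close> gV z(2)]
    have int: "integrable M (\<lambda>\<omega>. U \<omega> ^ k * V \<omega> ^ l)" for k l
    proof (rule Bochner_Integration.integrable_bound)
      show "integrable M (\<lambda>\<omega>. 1 + U \<omega> ^ (2 * (k + l)) + V \<omega> ^ (2 * (k + l)))"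
        by (intro Bochner_Integration.integrable_add iU iV integrable_const)
      show "AE \<omega> in M. norm (U \<omega> ^ k * V \<omega> ^ l) \<le> norm (1 + U \<omega> ^ (2 * (k + l)) + V \<omega> ^ (2 * (k + l)))"
        by (rule AE_I2) (unfold real_norm_def, rule order_trans[OF abs_power_mult_power_le abs_ge_self])
    qed measurable
    define a where "a = (\<integral>\<omega>. (U \<omega>)\<^sup>2 \<partial>M)"
    define b where "b = (\<integral>\<omega>. (V \<omega>)\<^sup>2 \<partial>M)"
    define r where "r = (\<integral>\<omega>. U \<omega> * V \<omega> \<partial>M)"
    have "a \<ge> 0" "b \<ge> 0" by (simp_all add: a_def b_def)
    have UV: "integrable M (\<lambda>\<omega>. U \<omega> * V \<omega>)" using int[of 1 1] by simp
    have "\<bar>r\<bar> \<le> (\<integral>\<omega>. ((U \<omega>)\<^sup>2 + (V \<omega>)\<^sup>2) / 2 \<partial>M)"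
      unfolding r_def
    proof (rule order_trans[OF integral_abs_bound integral_mono])
      show "\<bar>U \<omega> * V \<omega>\<bar> \<le> ((U \<omega>)\<^sup>2 + (V \<omega>)\<^sup>2) / 2" for \<omega>
        using sum_squares_bound[of "\<bar>U \<omega>\<bar>" "\<bar>V \<omega>\<bar>"] by (simp add: abs_mult)
    qed (use UV iU[of 2] iV[of 2] in auto)
    also have "\<dots> = (a + b) / 2"
      using iU[of 2] iV[of 2] by (simp add: a_def b_def)
    also have "\<dots> \<le> 2" using s by (simp add: a_def b_def)
    finally have "\<bar>r\<bar> \<le> 2" .
    define P where "P = (\<Sum>k\<le>4 * m. monom (real ((4 * m) choose k) * (\<integral>\<omega>. V \<omega> ^ k * U \<omega> ^ (4 * m - k) \<partial>M)) k)"
    define Q where "Q = smult (c (2 * m)) ([:a, 2 * r, b:] ^ (2 * m))"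
    have "poly P t = poly Q t" for t
    proof -
      have gt: "gaussian_rv M (\<lambda>\<omega>. t * V \<omega> + U \<omega>)" using g[of 1 t] by (simp add: add.commute)
      have zt: "(\<integral>\<omega>. t * V \<omega> + U \<omega> \<partial>M) = 0"
        using iU[of 1] iV[of 1] z by simp
      have "(\<integral>\<omega>. (t * V \<omega> + U \<omega>)\<^sup>2 \<partial>M) = (\<integral>\<omega>. t\<^sup>2 * (V \<omega>)\<^sup>2 + (2 * t) * (U \<omega> * V \<omega>) + (U \<omega>)\<^sup>2 \<partial>M)"
        by (simp add: power2_sum power_mult_distrib mult_ac add_ac)
      also have "\<dots> = a + 2 * t * r + t\<^sup>2 * b"
        using iU[of 2] iV[of 2] UV by (simp add: a_def b_def r_def)
      finally have sq: "(\<integral>\<omega>. (t * V \<omega> + U \<omega>)\<^sup>2 \<partial>M) = poly [:a, 2 * r, b:] t"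
        by (simp add: power2_eq_square algebra_simps)
      have "poly P t = (\<Sum>k\<le>4 * m. (\<integral>\<omega>. real ((4 * m) choose k) * (t * V \<omega>) ^ k * U \<omega> ^ (4 * m - k) \<partial>M))"
        unfolding P_def poly_sum poly_monom
        by (intro sum.cong refl) (simp add: power_mult_distrib mult_ac flip: integral_mult_right_zero)
      also have "\<dots> = (\<integral>\<omega>. (t * V \<omega> + U \<omega>) ^ (4 * m) \<partial>M)"
        unfolding binomial_ring
      proof (subst Bochner_Integration.integral_sum)
        fix k
        show "integrable M (\<lambda>\<omega>. real ((4 * m) choose k) * (t * V \<omega>) ^ k * U \<omega> ^ (4 * m - k))"
          using integrable_mult_right[OF int[of "4 * m - k" k], of "real ((4 * m) choose k) * t ^ k"]
          by (simp add: power_mult_distrib mult_ac)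
      qed simp
      also have "\<dots> = poly Q t"
        using even_moment_gaussian_rv[OF \<open>prob_space M\<close> gt zt, of "2 * m"]
        unfolding sq by (simp add: Q_def c_def)
      finally show ?thesis .
    qed
    then have PQ: "P = Q" by (simp add: poly_eq_poly_eq_iff[symmetric] fun_eq_iff)
    have cP: "coeff P (2 * m) = D * (\<integral>\<omega>. U \<omega> ^ (2 * m) * V \<omega> ^ (2 * m) \<partial>M)"
      unfolding P_def coeff_sum coeff_monom D_def
      by (subst sum.remove[of _ "2 * m"]) (auto simp: mult_ac)
    \<comment> \<open>This identity makes the coefficient at \<open>r = 0\<close> equal to
      \<open>D\<close> times the product of the two separate moments, so only the perturbation in
      \<open>r\<close> remains in the covariance.\<close>
    have cD: "c (2 * m) * real ((2 * m) choose m) = D * c m * c m"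
    proof -
      have 1: "real ((2 * m) choose m) = fact (2 * m) / (fact m * fact m)"
        by (subst binomial_fact) (auto simp: mult_2)
      have 2: "D = fact (4 * m) / (fact (2 * m) * fact (2 * m))"
        unfolding D_def by (subst binomial_fact) (auto simp: mult_2)
      show ?thesis unfolding 1 2 c_def
        by (simp add: field_simps power_mult power2_eq_square)
    qed
    have prod: "(\<integral>\<omega>. U \<omega> ^ (2 * m) \<partial>M) * (\<integral>\<omega>. V \<omega> ^ (2 * m) \<partial>M) = c m * c m * a ^ m * b ^ m"
      using even_moment_gaussian_rv[OF \<open>prob_space M\<close> gU z(1), of m]
        even_moment_gaussian_rv[OF \<open>prob_space M\<close> gV z(2), of m]
      by (simp add: a_def b_def c_def)
    have "D * ((\<integral>\<omega>. U \<omega> ^ (2 * m) * V \<omega> ^ (2 * m) \<partial>M) - (\<integral>\<omega>. U \<omega> ^ (2 * m) \<partial>M) * (\<integral>\<omega>. V \<omega> ^ (2 * m) \<partial>M))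
        = c (2 * m) * (coeff ([:a, 2 * r, b:] ^ (2 * m)) (2 * m) - coeff ([:a, 0, b:] ^ (2 * m)) (2 * m))"
      (is "D * ?X = _ * ?Y")
      unfolding right_diff_distrib prod cP[symmetric] PQ coeff_even_quadratic_power
      using cD by (simp add: Q_def algebra_simps)
    then have "?X = c (2 * m) / D * ?Y" using D by (simp add: field_simps)
    moreover have "\<bar>?Y\<bar> \<le> C * \<bar>r\<bar>" using C(2)[of a b r] s \<open>a \<ge> 0\<close> \<open>b \<ge> 0\<close> \<open>\<bar>r\<bar> \<le> 2\<close>
      by (simp add: a_def b_def)
    moreover have "c (2 * m) / D \<ge> 0" using D by (simp add: c_def)
    ultimately have "\<bar>?X\<bar> \<le> c (2 * m) / D * (C * \<bar>r\<bar>)"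
      by (simp only: abs_mult abs_of_nonneg mult_left_mono)
    then show ?thesis by (simp add: r_def mult.assoc)
  qed
  moreover have "c (2 * m) / D * C \<ge> 0" using C(1) D by (simp add: c_def)
  ultimately show thesis using that by blast
qed

subsection \<open>Increments of the covariance function\<close>

lemma powr_increment_antimono:
  fixes c x y d :: real
  assumes c: "0 < c" "c \<le> 1" and x: "0 \<le> x" "x \<le> y" and d: "0 \<le> d"
  shows "(y + d) powr c - y powr c \<le> (x + d) powr c - x powr c"
proof (rule DERIV_nonpos_imp_decreasing_open[OF x(2)])
  fix z assume z: "x < z" "z < y"
  have "((\<lambda>z. (z + d) powr c - z powr c) has_real_derivative c * (z + d) powr (c - 1) - c * z powr (c - 1)) (at z)"
    using z x d by (auto intro!: derivative_eq_intros)
  moreover have "(z + d) powr (c - 1) \<le> z powr (c - 1)"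
    using z x d c by (intro powr_mono2') auto
  ultimately show "\<exists>y. ((\<lambda>z. (z + d) powr c - z powr c) has_real_derivative y) (at z) \<and> y \<le> 0"
    using c by (auto intro!: exI mult_left_mono)
next
  show "continuous_on {x..y} (\<lambda>z. (z + d) powr c - z powr c)"
    using x d c by (intro continuous_intros continuous_on_powr') auto
qed

lemma powr_increment_mono:
  fixes c x y d :: real
  assumes c: "1 \<le> c" and x: "0 \<le> x" "x \<le> y" and d: "0 \<le> d"
  shows "(x + d) powr c - x powr c \<le> (y + d) powr c - y powr c"
proof (rule DERIV_nonneg_imp_increasing_open[OF x(2)])
  fix z assume z: "x < z" "z < y"
  have "((\<lambda>z. (z + d) powr c - z powr c) has_real_derivative c * (z + d) powr (c - 1) - c * z powr (c - 1)) (at z)"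
    using z x d by (auto intro!: derivative_eq_intros)
  moreover have "z powr (c - 1) \<le> (z + d) powr (c - 1)"
    using z x d c by (intro powr_mono2) auto
  ultimately show "\<exists>y. ((\<lambda>z. (z + d) powr c - z powr c) has_real_derivative y) (at z) \<and> 0 \<le> y"
    using c by (auto intro!: exI mult_left_mono)
next
  show "continuous_on {x..y} (\<lambda>z. (z + d) powr c - z powr c)"
    using x d c by (intro continuous_intros continuous_on_powr') auto
qed

text \<open>For \<open>c \<le> 1\<close> this is subadditivity of the power; for
  \<open>c > 1\<close> the mean value theorem applies, with derivative at most
  \<open>2 * 2 = 4\<close> because \<open>c\<close> and the argument are at most 2.
  \<open>min 1 c\<close> covers both regimes.\<close>

lemma powr_diff_le:
  fixes c x y :: real
  assumes c: "0 < c" "c \<le> 2" and xy: "0 \<le> x" "x \<le> y" "y \<le> 2"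
  shows "y powr c - x powr c \<le> 4 * (y - x) powr min 1 c"
proof (cases "c \<le> 1")
  case True
  have "y powr c - x powr c \<le> (y - x) powr c"
    using powr_increment_antimono[of c 0 x "y - x"] c True xy by simp
  also have "\<dots> \<le> 4 * (y - x) powr c" by simp
  finally show ?thesis using True by (simp add: min_def)
next
  case False
  show ?thesis
  proof (cases "x = y")
    case neq: False
    have "\<exists>l z. x < z \<and> z < y \<and> ((\<lambda>z. z powr c) has_real_derivative l) (at z) \<and>
        y powr c - x powr c = (y - x) * l"
    proof (rule MVT)
      show "x < y" using neq xy by simp
      show "continuous_on {x..y} (\<lambda>z. z powr c)"
        using xy c by (intro continuous_intros continuous_on_powr') auto
      show "(\<lambda>z. z powr c) differentiable (at z)" if "x < z" "z < y" for z
        using has_real_derivative_powr[of z c] that xy real_differentiable_def by auto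
    qed
    then obtain l z where z: "x < z" "z < y" "((\<lambda>z. z powr c) has_real_derivative l) (at z)"
      "y powr c - x powr c = (y - x) * l" by blast
    have "l = c * z powr (c - 1)"
      using DERIV_unique[OF z(3) has_real_derivative_powr] z xy by simp
    moreover have "z powr (c - 1) \<le> 2 powr (c - 1)" using z xy False by (intro powr_mono2) auto
    moreover have "(2::real) powr (c - 1) \<le> 2 powr 1" using c by (intro powr_mono) auto
    ultimately have "l \<le> 4" using mult_mono[of c 2 "z powr (c - 1)" 2] c by simp
    then have "(y - x) * l \<le> (y - x) * 4" using xy by (intro mult_left_mono) auto
    then show ?thesis using z(4) False xy neq by (simp add: min_def)
  qed simp
qed

lemma abs_powr_diff_le:
  fixes c u v :: real
  assumes c: "0 < c" "c \<le> 2" and uv: "\<bar>u\<bar> \<le> 2" "\<bar>v\<bar> \<le> 2" "\<bar>u - v\<bar> \<le> h"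
  shows "\<bar>\<bar>u\<bar> powr c - \<bar>v\<bar> powr c\<bar> \<le> 4 * h powr min 1 c"
proof -
  have *: "\<bar>\<bar>u\<bar> powr c - \<bar>v\<bar> powr c\<bar> \<le> 4 * h powr min 1 c"
    if "\<bar>u\<bar> \<le> 2" "\<bar>v\<bar> \<le> 2" "\<bar>u - v\<bar> \<le> h" "\<bar>v\<bar> \<le> \<bar>u\<bar>" for u v
  proof -
    have "\<bar>v\<bar> powr c \<le> \<bar>u\<bar> powr c" using that c by (intro powr_mono2) auto
    then have "\<bar>\<bar>u\<bar> powr c - \<bar>v\<bar> powr c\<bar> = \<bar>u\<bar> powr c - \<bar>v\<bar> powr c" by simp
    also have "\<dots> \<le> 4 * (\<bar>u\<bar> - \<bar>v\<bar>) powr min 1 c" using that c by (intro powr_diff_le) auto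
    also have "\<dots> \<le> 4 * h powr min 1 c"
      using that c by (intro mult_left_mono powr_mono2) auto
    finally show ?thesis .
  qed
  show ?thesis using *[of u v] *[of v u] uv by (cases "\<bar>v\<bar> \<le> \<bar>u\<bar>") (auto simp: abs_minus_commute)
qed

text \<open>Telescoping: the shifted and the unshifted integral cancel except on two end intervals
  of length \<open>h\<close>, each contributing at most \<open>h * c\<close>.\<close>

lemma abs_integral_increment_le:
  fixes g :: "real \<Rightarrow> real"
  assumes h: "0 \<le> h" and ab: "a \<le> b" and cont: "continuous_on {a..b + h} g"
    and c: "\<And>x. x \<in> {a..b + h} \<Longrightarrow> \<bar>g x\<bar> \<le> c"
  shows "\<bar>integral {a..b} (\<lambda>x. g (x + h) - g x)\<bar> \<le> 2 * h * c"
proof -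
  have int: "g integrable_on {u..v}" if "a \<le> u" "v \<le> b + h" for u v
    by (rule integrable_continuous_interval[OF continuous_on_subset[OF cont]]) (use that in auto)
  have s: "(\<lambda>x. g (x + h)) integrable_on {a..b}" "integral {a..b} (\<lambda>x. g (x + h)) = integral {a + h..b + h} g"
    using integrable_shift_real_ivl[OF int[of "a + h" "b + h"], of h]
      integral_shift_real_ivl[where a = "a + h" and b = "b + h" and c = h and f = g] h by auto
  have "integral {a..b} (\<lambda>x. g (x + h) - g x) = integral {a + h..b + h} g - integral {a..b} g"
    using s h by (simp add: integral_diff int)
  also have "\<dots> = integral {b..b + h} g - integral {a..a + h} g"
    using Henstock_Kurzweil_Integration.integral_combine[where a = a and c = "a + h" and b = "b + h" and f = g]
      Henstock_Kurzweil_Integration.integral_combine[where a = a and c = b and b = "b + h" and f = g] h ab int by simp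
  finally have eq: "integral {a..b} (\<lambda>x. g (x + h) - g x) = integral {b..b + h} g - integral {a..a + h} g" .
  have bd: "\<bar>integral {u..u + h} g\<bar> \<le> c * h" if "a \<le> u" "u \<le> b" for u
  proof -
    have "norm (integral {u..u + h} g) \<le> c * (u + h - u)"
      by (rule integral_bound) (use h that c in \<open>auto intro!: continuous_on_subset[OF cont]\<close>)
    then show ?thesis by simp
  qed
  show ?thesis unfolding eq using bd[of a] bd[of b] ab by (simp add: mult_ac)
qed

text \<open>With \<open>r = x - y\<close>, the strip from 0 to \<open>h\<close> is bounded by its
  length times the pointwise bound \<open>8 * e\<close>. For \<open>r \<ge> h\<close> the second
  difference has one sign, by concavity (\<open>c \<le> 1\<close>) or convexity
  (\<open>c > 1\<close>), so the modulus leaves the integral, which then telescopes to at most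
  \<open>8 * e * h\<close>. Evenness in \<open>r\<close> doubles the sum to
  \<open>32 * e * h\<close>.\<close>

lemma integral_abs_second_difference_le:
  fixes c h y :: real
  assumes c: "0 < c" "c \<le> 2" and h: "0 < h" "h \<le> 1" and y: "0 \<le> y" "y \<le> 1"
  shows "integral {0..1 - h} (\<lambda>x. \<bar>\<bar>x - y + h\<bar> powr c - 2 * \<bar>x - y\<bar> powr c + \<bar>x - y - h\<bar> powr c\<bar>)
    \<le> 32 * h powr (1 + min 1 c)"
proof -
  define K where "K r = \<bar>r + h\<bar> powr c - 2 * \<bar>r\<bar> powr c + \<bar>r - h\<bar> powr c" for r
  define e where "e = h powr min 1 c"
  have e: "e \<ge> 0" by (simp add: e_def)
  have contp: "continuous_on S (\<lambda>r. \<bar>r + u\<bar> powr c)" for u S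
    using c by (intro continuous_on_powr' continuous_intros) auto
  have contK: "continuous_on S K" for S
    unfolding K_def using contp[of S h] contp[of S 0] contp[of S "- h"]
    by (auto intro!: continuous_on_add continuous_on_diff continuous_on_mult_left)
  have contA: "continuous_on S (\<lambda>r. \<bar>K r\<bar>)" for S by (intro continuous_intros contK)
  have intA: "(\<lambda>r. \<bar>K r\<bar>) integrable_on {u..v}" for u v by (rule integrable_continuous_interval[OF contA])
  have even: "\<bar>K (- r)\<bar> = \<bar>K r\<bar>" for r
  proof -
    have n: "\<bar>- r + h\<bar> = \<bar>r - h\<bar>" "\<bar>- r - h\<bar> = \<bar>r + h\<bar>" by auto
    have "K (- r) = K r" unfolding K_def n abs_minus_cancel by linarith
    then show ?thesis by simp
  qed
  have near: "\<bar>K r\<bar> \<le> 8 * e" if "\<bar>r\<bar> \<le> 1" for r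
  proof -
    have "\<bar>\<bar>r + h\<bar> powr c - \<bar>r\<bar> powr c\<bar> \<le> 4 * e" "\<bar>\<bar>r - h\<bar> powr c - \<bar>r\<bar> powr c\<bar> \<le> 4 * e"
      unfolding e_def by (rule abs_powr_diff_le[OF c]; use that h in auto)+
    then show ?thesis unfolding K_def by linarith
  qed
  have part1: "integral {0..h} (\<lambda>r. \<bar>K r\<bar>) \<le> 8 * e * h"
  proof -
    have "norm (integral {0..h} (\<lambda>r. \<bar>K r\<bar>)) \<le> 8 * e * (h - 0)"
      by (rule integral_bound) (use h near contA in auto)
    then show ?thesis by simp
  qed
  have part2: "integral {h..1} (\<lambda>r. \<bar>K r\<bar>) \<le> 8 * e * h"
  proof -
    define g where "g r = \<bar>r + h\<bar> powr c - \<bar>r\<bar> powr c" for r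
    \<comment> \<open>The second difference is the increment of a first difference \<open>g\<close>,
      which is of size at most \<open>4 * e\<close>; this is the form that telescopes.\<close>
    have Kg: "K (r + h) = g (r + h) - g r" for r by (simp add: K_def g_def)
    have "integral {h..1} (\<lambda>r. \<bar>K r\<bar>) = integral {0..1 - h} (\<lambda>r. \<bar>K (r + h)\<bar>)"
      using integral_shift_real_ivl[where a = h and b = 1 and c = h and f = "\<lambda>r. \<bar>K r\<bar>"] by simp
    also have "\<dots> = \<bar>integral {0..1 - h} (\<lambda>r. K (r + h))\<bar>"
    proof (cases "c \<le> 1")
      case True
      have neg: "K (r + h) \<le> 0" if "r \<in> {0..1 - h}" for r
        using powr_increment_antimono[of c r "r + h" h] c True that h by (simp add: K_def)
      then have "integral {0..1 - h} (\<lambda>r. \<bar>K (r + h)\<bar>) = integral {0..1 - h} (\<lambda>r. - K (r + h))"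
        by (intro integral_cong) auto
      moreover have "integral {0..1 - h} (\<lambda>r. K (r + h)) \<le> integral {0..1 - h} (\<lambda>r. 0)"
        by (rule integral_le) (use neg in \<open>auto intro!: integrable_continuous_interval continuous_on_compose2[OF contK[of UNIV]] continuous_intros\<close>)
      ultimately show ?thesis by simp
    next
      case False
      have pos: "0 \<le> K (r + h)" if "r \<in> {0..1 - h}" for r
        using powr_increment_mono[of c r "r + h" h] c False that h by (simp add: K_def)
      then have "integral {0..1 - h} (\<lambda>r. \<bar>K (r + h)\<bar>) = integral {0..1 - h} (\<lambda>r. K (r + h))"
        by (intro integral_cong) auto
      moreover have "0 \<le> integral {0..1 - h} (\<lambda>r. K (r + h))"
        using pos by (intro integral_nonneg)
          (auto intro!: integrable_continuous_interval continuous_on_compose2[OF contK[of UNIV]] continuous_intros)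
      ultimately show ?thesis by simp
    qed
    also have "\<dots> \<le> 2 * h * (4 * e)"
      unfolding Kg
    proof (rule abs_integral_increment_le)
      show "continuous_on {0..1 - h + h} g"
        unfolding g_def using contp[of _ h] contp[of _ 0] by (auto intro!: continuous_on_diff)
      show "\<bar>g x\<bar> \<le> 4 * e" if "x \<in> {0..1 - h + h}" for x
        unfolding g_def e_def by (rule abs_powr_diff_le[OF c]) (use that h in auto)
    qed (use h in auto)
    finally show ?thesis by (simp add: mult_ac)
  qed
  have half: "integral {0..1} (\<lambda>r. \<bar>K r\<bar>) \<le> 16 * e * h"
    using part1 part2 Henstock_Kurzweil_Integration.integral_combine[where a = 0 and c = h and b = 1 and f = "\<lambda>r. \<bar>K r\<bar>"] h intA by simp
  have "integral {-1..0} (\<lambda>r. \<bar>K r\<bar>) = integral {0..1} (\<lambda>r. \<bar>K r\<bar>)"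
    using Henstock_Kurzweil_Integration.integral_reflect_real[where b = 1 and a = 0 and f = "\<lambda>r. \<bar>K r\<bar>"]
    by (simp add: even)
  then have full: "integral {-1..1} (\<lambda>r. \<bar>K r\<bar>) \<le> 32 * e * h"
    using half Henstock_Kurzweil_Integration.integral_combine[where a = "-1" and c = 0 and b = 1 and f = "\<lambda>r. \<bar>K r\<bar>"] intA by simp
  have "integral {0..1 - h} (\<lambda>x. \<bar>K (x - y)\<bar>) = integral {- y..1 - h - y} (\<lambda>r. \<bar>K r\<bar>)"
    using integral_shift_real_ivl[where a = "- y" and b = "1 - h - y" and c = "- y" and f = "\<lambda>r. \<bar>K r\<bar>"] by simp
  also have "\<dots> \<le> integral {-1..1} (\<lambda>r. \<bar>K r\<bar>)"
    by (rule integral_subset_le) (use h y intA in auto)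
  also note full
  finally show ?thesis using h by (simp add: K_def e_def powr_add mult_ac)
qed

text \<open>Applied to a kernel whose mixed differences have a constant sign, this bounds the double
  integral of their modulus.\<close>

lemma integral_mixed_difference_le:
  fixes F :: "real \<Rightarrow> real \<Rightarrow> real"
  assumes cont: "continuous_on ({0..1} \<times> {0..1}) (\<lambda>(x, y). F x y)"
    and bd: "\<And>x y. x \<in> {0..1} \<Longrightarrow> y \<in> {0..1} \<Longrightarrow> \<bar>F x y\<bar> \<le> c" and h: "0 \<le> h" "h \<le> 1"
  shows "\<bar>integral {0..1 - h} (\<lambda>x. integral {0..1 - h}
      (\<lambda>y. F (x + h) (y + h) - F (x + h) y - F x (y + h) + F x y))\<bar> \<le> 4 * h\<^sup>2 * c"
proof -
  \<comment> \<open>Telescoping is applied twice: in \<open>y\<close> it bounds \<open>P\<close> by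
    \<open>2 * h * c\<close>, and in \<open>x\<close> it gains the second factor
    \<open>2 * h\<close>.\<close>
  define P where "P x = integral {0..1 - h} (\<lambda>y. F x (y + h) - F x y)" for x
  have c1: "continuous_on {0..1} (F x)" if "x \<in> {0..1}" for x
  proof -
    have "continuous_on {0..1} (\<lambda>y::real. (x, y))"
      by (rule continuous_on_Pair[OF continuous_on_const continuous_on_id])
    then have "continuous_on {0..1} (\<lambda>y. case (x, y) of (x, y) \<Rightarrow> F x y)"
      by (rule continuous_on_compose2[OF cont]) (use that in auto)
    then show ?thesis by simp
  qed
  have c2: "continuous_on {0..1 - h} (\<lambda>y. F x (y + h) - F x y)" if "x \<in> {0..1}" for x
    using h by (intro continuous_intros continuous_on_compose2[OF c1[OF that]]) auto
  have "continuous_on {0..1} (\<lambda>x. integral (cbox 0 (1 - h)) (\<lambda>y. F x (y + h) - F x y))"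
  proof (rule integral_continuous_on_param)
    show "continuous_on ({0..1} \<times> cbox 0 (1 - h)) (\<lambda>(x, y). F x (y + h) - F x y)"
    proof -
      have "continuous_on ({0..1} \<times> {0..1 - h}) (\<lambda>z. case (fst z, snd z + h) of (x, y) \<Rightarrow> F x y)"
        by (rule continuous_on_compose2[OF cont]) (use h in \<open>auto intro!: continuous_intros\<close>)
      moreover have "continuous_on ({0..1} \<times> {0..1 - h}) (\<lambda>(x, y). F x y)"
        by (rule continuous_on_subset[OF cont]) (use h in auto)
      ultimately show ?thesis by (auto simp: split_beta intro!: continuous_on_diff)
    qed
  qed
  then have "continuous_on {0..1} P" by (simp add: P_def)
  moreover have "\<bar>P x\<bar> \<le> 2 * h * c" if "x \<in> {0..1}" for x
    unfolding P_def by (rule abs_integral_increment_le) (use c1[OF that] bd[OF that] h in auto)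
  ultimately have "\<bar>integral {0..1 - h} (\<lambda>x. P (x + h) - P x)\<bar> \<le> 2 * h * (2 * h * c)"
    using h by (intro abs_integral_increment_le) auto
  moreover have "integral {0..1 - h} (\<lambda>x. P (x + h) - P x) = integral {0..1 - h} (\<lambda>x. integral {0..1 - h}
      (\<lambda>y. F (x + h) (y + h) - F (x + h) y - F x (y + h) + F x y))"
  proof (rule integral_cong)
    fix x assume x: "x \<in> {0..1 - h}"
    then have "P (x + h) - P x = integral {0..1 - h} (\<lambda>y. (F (x + h) (y + h) - F (x + h) y) - (F x (y + h) - F x y))"
      unfolding P_def using h
      by (subst integral_diff) (auto intro!: integrable_continuous_interval c2)
    then show "P (x + h) - P x = integral {0..1 - h} (\<lambda>y. F (x + h) (y + h) - F (x + h) y - F x (y + h) + F x y)"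
      by (simp add: algebra_simps)
  qed
  ultimately show ?thesis by (simp add: power2_eq_square mult_ac)
qed

section \<open>Covariance and variance of increments of the process\<close>

context
  fixes \<alpha> \<beta> :: real
  assumes \<alpha>: "0 < \<alpha>" "\<alpha> < 1" and \<beta>: "0 < \<beta>" "\<beta> \<le> 1"
begin

definition incr_cov :: "real \<Rightarrow> real \<Rightarrow> real \<Rightarrow> real" where
  "incr_cov h x y = bifractional_cov \<alpha> \<beta> (x + h) (y + h) - bifractional_cov \<alpha> \<beta> (x + h) y
     - bifractional_cov \<alpha> \<beta> x (y + h) + bifractional_cov \<alpha> \<beta> x y"

text \<open>The first mixed difference is nonpositive, so its modulus is written as its negative: in
  this form it still telescopes under the double integral. The second difference changes sign near
  the diagonal and keeps its modulus. The prefactor \<open>1 / 2 powr \<beta>\<close>, being at most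
  1, is dropped.\<close>

definition incr_cov_bound :: "real \<Rightarrow> real \<Rightarrow> real \<Rightarrow> real" where
  "incr_cov_bound h x y =
     - (((y + h) powr (2 * \<alpha>) + (x + h) powr (2 * \<alpha>)) powr \<beta> - (y powr (2 * \<alpha>) + (x + h) powr (2 * \<alpha>)) powr \<beta>
        - ((y + h) powr (2 * \<alpha>) + x powr (2 * \<alpha>)) powr \<beta> + (y powr (2 * \<alpha>) + x powr (2 * \<alpha>)) powr \<beta>)
     + \<bar>\<bar>x - y + h\<bar> powr (2 * \<alpha> * \<beta>) - 2 * \<bar>x - y\<bar> powr (2 * \<alpha> * \<beta>) + \<bar>x - y - h\<bar> powr (2 * \<alpha> * \<beta>)\<bar>"

lemma exponent_bounds: "0 < 2 * \<alpha> * \<beta>" "2 * \<alpha> * \<beta> < 2" "\<alpha> * \<beta> < 1"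
proof -
  have "\<alpha> * \<beta> \<le> \<alpha>" using \<alpha> \<beta> by (simp add: mult_left_le)
  then show "2 * \<alpha> * \<beta> < 2" "\<alpha> * \<beta> < 1" using \<alpha> by linarith+
  show "0 < 2 * \<alpha> * \<beta>" using \<alpha> \<beta> by simp
qed

text \<open>Concavity of the power \<open>\<beta>\<close>: the gain from enlarging the
  \<open>y\<close> summand is smaller when the \<open>x\<close> summand is already larger.\<close>

lemma sum_powr_mixed_difference_nonpos:
  assumes "0 \<le> x" "0 \<le> y" "0 \<le> h"
  shows "((y + h) powr (2 * \<alpha>) + (x + h) powr (2 * \<alpha>)) powr \<beta> - (y powr (2 * \<alpha>) + (x + h) powr (2 * \<alpha>)) powr \<beta>
        - ((y + h) powr (2 * \<alpha>) + x powr (2 * \<alpha>)) powr \<beta> + (y powr (2 * \<alpha>) + x powr (2 * \<alpha>)) powr \<beta> \<le> 0"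
proof -
  have m: "x powr (2 * \<alpha>) \<le> (x + h) powr (2 * \<alpha>)" "y powr (2 * \<alpha>) \<le> (y + h) powr (2 * \<alpha>)"
    using assms \<alpha> by (auto intro!: powr_mono2)
  show ?thesis
    using powr_increment_antimono[OF \<beta>, of "y powr (2 * \<alpha>) + x powr (2 * \<alpha>)" "y powr (2 * \<alpha>) + (x + h) powr (2 * \<alpha>)"
        "(y + h) powr (2 * \<alpha>) - y powr (2 * \<alpha>)"] m by (simp add: add_ac)
qed

lemma abs_incr_cov_le:
  assumes "0 \<le> x" "0 \<le> y" "0 \<le> h"
  shows "\<bar>incr_cov h x y\<bar> \<le> incr_cov_bound h x y"
proof -
  define A where "A = ((y + h) powr (2 * \<alpha>) + (x + h) powr (2 * \<alpha>)) powr \<beta> - (y powr (2 * \<alpha>) + (x + h) powr (2 * \<alpha>)) powr \<beta>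
        - ((y + h) powr (2 * \<alpha>) + x powr (2 * \<alpha>)) powr \<beta> + (y powr (2 * \<alpha>) + x powr (2 * \<alpha>)) powr \<beta>"
  define K where "K = \<bar>x - y + h\<bar> powr (2 * \<alpha> * \<beta>) - 2 * \<bar>x - y\<bar> powr (2 * \<alpha> * \<beta>) + \<bar>x - y - h\<bar> powr (2 * \<alpha> * \<beta>)"
  have "A \<le> 0" using sum_powr_mixed_difference_nonpos[OF assms] by (simp add: A_def)
  have a: "\<bar>y + h - (x + h)\<bar> = \<bar>x - y\<bar>" "\<bar>y - (x + h)\<bar> = \<bar>x - y + h\<bar>"
    "\<bar>y + h - x\<bar> = \<bar>x - y - h\<bar>" "\<bar>y - x\<bar> = \<bar>x - y\<bar>" by auto
  have "incr_cov h x y = 1 / 2 powr \<beta> * (A + K)"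
    unfolding incr_cov_def bifractional_cov_def a A_def K_def by (simp add: algebra_simps)
  then have "\<bar>incr_cov h x y\<bar> = 1 / 2 powr \<beta> * \<bar>A + K\<bar>" by (simp add: abs_mult)
  also have "\<dots> \<le> 1 * \<bar>A + K\<bar>"
    using \<beta> ge_one_powr_ge_zero[of 2 \<beta>] by (intro mult_right_mono) (auto simp: divide_le_eq)
  also have "\<dots> \<le> - A + \<bar>K\<bar>" using \<open>A \<le> 0\<close> by simp
  finally show ?thesis by (simp add: incr_cov_bound_def A_def K_def)
qed

lemma continuous_on_sum_powr: "continuous_on S (\<lambda>(x, y). (\<bar>y\<bar> powr (2 * \<alpha>) + \<bar>x\<bar> powr (2 * \<alpha>)) powr \<beta>)"
  unfolding split_beta using \<alpha> \<beta> by (intro continuous_on_powr' continuous_intros) auto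

lemma continuous_on_incr_cov_bound:
  assumes "0 \<le> h"
  shows "continuous_on ({0..} \<times> {0..}) (\<lambda>(x, y). incr_cov_bound h x y)"
  unfolding split_beta incr_cov_bound_def using \<alpha> \<beta> assms
  by (intro continuous_on_powr' continuous_intros) auto

text \<open>The first term telescopes to at most \<open>8 * h\<^sup>2\<close>, as the kernel is at
  most 2, and \<open>h\<^sup>2\<close> is absorbed since \<open>h \<le> 1\<close>; the
  second-difference term contributes 32. Together this is the constant 40.\<close>

lemma integral_incr_cov_bound_le:
  assumes h: "0 < h" "h \<le> 1"
  shows "integral {0..1 - h} (\<lambda>x. integral {0..1 - h} (\<lambda>y. incr_cov_bound h x y))
    \<le> 40 * h powr (1 + min 1 (2 * \<alpha> * \<beta>))"
proof -
  let ?I = "{0..1 - h}"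
  \<comment> \<open>The absolute values change nothing for nonnegative times and make
    \<open>F\<close> continuous on the whole plane, which spares domain conditions below.\<close>
  define F where "F x y = (\<bar>y\<bar> powr (2 * \<alpha>) + \<bar>x\<bar> powr (2 * \<alpha>)) powr \<beta>" for x y
  define A where "A x y = F (x + h) (y + h) - F (x + h) y - F x (y + h) + F x y" for x y
  define K where "K x y = \<bar>\<bar>x - y + h\<bar> powr (2 * \<alpha> * \<beta>) - 2 * \<bar>x - y\<bar> powr (2 * \<alpha> * \<beta>) + \<bar>x - y - h\<bar> powr (2 * \<alpha> * \<beta>)\<bar>" for x y
  note eb = exponent_bounds
  have contF: "continuous_on S (\<lambda>(x, y). F x y)" for S
    unfolding F_def by (rule continuous_on_sum_powr)
  have contA: "continuous_on UNIV (\<lambda>(x, y). A x y)"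
    unfolding A_def F_def split_beta using \<alpha> \<beta> by (intro continuous_on_powr' continuous_intros) auto
  have contK: "continuous_on UNIV (\<lambda>(x, y). K x y)"
    unfolding K_def split_beta using eb by (intro continuous_on_powr' continuous_intros) auto
  have slice: "continuous_on S (G x)" "(\<lambda>x. integral ?I (G x)) integrable_on ?I"
    if G: "continuous_on UNIV (\<lambda>(x, y). G x y :: real)" for S G x
  proof -
    show "continuous_on S (G x)"
      using continuous_on_compose2[OF G, of S "\<lambda>y. (x, y)"]
        continuous_on_Pair[OF continuous_on_const continuous_on_id, of _ x] by auto
    have "continuous_on ?I (\<lambda>x. integral (cbox 0 (1 - h)) (G x))"
      by (rule integral_continuous_on_param) (rule continuous_on_subset[OF G], simp)
    then show "(\<lambda>x. integral ?I (G x)) integrable_on ?I"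
      by (intro integrable_continuous_interval) simp
  qed
  have "integral ?I (\<lambda>x. integral ?I (\<lambda>y. incr_cov_bound h x y)) =
      integral ?I (\<lambda>x. - integral ?I (A x) + integral ?I (K x))"
  proof (rule integral_cong)
    fix x assume x: "x \<in> ?I"
    have "integral ?I (\<lambda>y. incr_cov_bound h x y) = integral ?I (\<lambda>y. - A x y + K x y)"
      using h x by (intro integral_cong) (auto simp: incr_cov_bound_def A_def F_def K_def)
    also have "\<dots> = integral ?I (\<lambda>y. - A x y) + integral ?I (K x)"
      by (rule integral_add)
        (auto intro!: integrable_continuous_interval continuous_on_minus slice(1)[OF contA] slice(1)[OF contK])
    finally show "integral ?I (\<lambda>y. incr_cov_bound h x y) = - integral ?I (A x) + integral ?I (K x)"
      by simp
  qed
  also have "\<dots> = - integral ?I (\<lambda>x. integral ?I (A x)) + integral ?I (\<lambda>x. integral ?I (K x))"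
    by (subst integral_add) (use slice(2)[OF contA] slice(2)[OF contK] in \<open>auto intro: integrable_neg\<close>)
  also have "- integral ?I (\<lambda>x. integral ?I (A x)) \<le> 4 * h\<^sup>2 * 2"
  proof -
    have "\<bar>integral ?I (\<lambda>x. integral ?I (A x))\<bar> \<le> 4 * h\<^sup>2 * 2"
      unfolding A_def
    proof (rule integral_mixed_difference_le[OF contF])
      fix x y :: real assume xy: "x \<in> {0..1}" "y \<in> {0..1}"
      have "\<bar>y\<bar> powr (2 * \<alpha>) + \<bar>x\<bar> powr (2 * \<alpha>) \<le> 1 + 1"
        using xy \<alpha> by (intro add_mono powr_le1) auto
      then have "F x y \<le> 2 powr \<beta>" unfolding F_def using \<beta> by (intro powr_mono2) auto
      also have "\<dots> \<le> 2 powr 1" using \<beta> by (intro powr_mono) auto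
      finally show "\<bar>F x y\<bar> \<le> 2" by (simp add: F_def)
    qed (use h in auto)
    then show ?thesis by linarith
  qed
  also have "integral ?I (\<lambda>x. integral ?I (K x)) \<le> integral ?I (\<lambda>x. 32 * h powr (1 + min 1 (2 * \<alpha> * \<beta>)))"
  proof (rule integral_le[OF slice(2)[OF contK]])
    fix x assume x: "x \<in> ?I"
    \<comment> \<open>The second-difference estimate integrates over the first variable; since
      \<open>K\<close> is symmetric in \<open>x\<close> and \<open>y\<close>, the roles can be
      exchanged.\<close>
    have "integral ?I (K x) = integral ?I (\<lambda>y. \<bar>\<bar>y - x + h\<bar> powr (2 * \<alpha> * \<beta>) - 2 * \<bar>y - x\<bar> powr (2 * \<alpha> * \<beta>) + \<bar>y - x - h\<bar> powr (2 * \<alpha> * \<beta>)\<bar>)"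
    proof (rule integral_cong)
      fix y
      have a: "\<bar>x - y + h\<bar> = \<bar>y - x - h\<bar>" "\<bar>x - y - h\<bar> = \<bar>y - x + h\<bar>" "\<bar>x - y\<bar> = \<bar>y - x\<bar>" by auto
      show "K x y = \<bar>\<bar>y - x + h\<bar> powr (2 * \<alpha> * \<beta>) - 2 * \<bar>y - x\<bar> powr (2 * \<alpha> * \<beta>) + \<bar>y - x - h\<bar> powr (2 * \<alpha> * \<beta>)\<bar>"
        unfolding K_def a by (rule arg_cong[where f = abs]) linarith
    qed
    also have "\<dots> \<le> 32 * h powr (1 + min 1 (2 * \<alpha> * \<beta>))"
      by (rule integral_abs_second_difference_le) (use eb h x in auto)
    finally show "integral ?I (K x) \<le> 32 * h powr (1 + min 1 (2 * \<alpha> * \<beta>))" .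
  qed auto
  also have "\<dots> \<le> 32 * h powr (1 + min 1 (2 * \<alpha> * \<beta>))"
    using h by (simp add: mult_left_le_one_le)
  also have "h\<^sup>2 \<le> h powr (1 + min 1 (2 * \<alpha> * \<beta>))"
    using powr_mono'[of "1 + min 1 (2 * \<alpha> * \<beta>)" 2 h] h by simp
  finally show ?thesis by simp
qed

text \<open>The variance is an exact power of \<open>h\<close> minus twice the midpoint concavity
  defect of the power \<open>\<beta>\<close> between \<open>x powr (2 * \<alpha>)\<close> and
  \<open>(x + h) powr (2 * \<alpha>)\<close>. The defect is nonnegative, which gives the upper
  bound; the lower bound needs it to be small.\<close>

lemma incr_cov_diag:
  assumes "0 \<le> x" "0 < h"
  shows "incr_cov h x x = 2 powr (1 - \<beta>) * h powr (2 * \<alpha> * \<beta>)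
    - (2 * ((x powr (2 * \<alpha>) + (x + h) powr (2 * \<alpha>)) / 2) powr \<beta>
       - (x powr (2 * \<alpha>)) powr \<beta> - ((x + h) powr (2 * \<alpha>)) powr \<beta>)"
proof -
  define a where "a = x powr (2 * \<alpha>)"
  define b where "b = (x + h) powr (2 * \<alpha>)"
  have ab: "0 \<le> a" "0 \<le> b" by (simp_all add: a_def b_def)
  have "incr_cov h x x = 1 / 2 powr \<beta> * ((2 * b) powr \<beta> + (2 * a) powr \<beta> - 2 * (a + b) powr \<beta> + 2 * h powr (2 * \<alpha> * \<beta>))"
    unfolding incr_cov_def bifractional_cov_def a_def b_def
    using assms \<alpha> \<beta> by (simp add: algebra_simps)
  also have "\<dots> = b powr \<beta> + a powr \<beta> - 2 * ((a + b) / 2) powr \<beta> + 2 powr (1 - \<beta>) * h powr (2 * \<alpha> * \<beta>)"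
    using ab by (simp add: powr_mult powr_divide powr_diff field_simps)
  finally show ?thesis unfolding a_def b_def by simp
qed

lemma incr_cov_diag_le:
  assumes "0 \<le> x" "0 < h"
  shows "incr_cov h x x \<le> 2 * h powr (2 * \<alpha> * \<beta>)"
proof -
  define a where "a = x powr (2 * \<alpha>)"
  define b where "b = (x + h) powr (2 * \<alpha>)"
  have ab: "0 \<le> a" "a \<le> b" using assms \<alpha> by (auto simp: a_def b_def intro!: powr_mono2)
  have "((a + b) / 2 + (b - a) / 2) powr \<beta> - ((a + b) / 2) powr \<beta> \<le> (a + (b - a) / 2) powr \<beta> - a powr \<beta>"
    by (rule powr_increment_antimono[OF \<beta>]) (use ab in auto)
  moreover have "(a + b) / 2 + (b - a) / 2 = b" "a + (b - a) / 2 = (a + b) / 2" by (simp_all add: field_simps)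
  ultimately have "0 \<le> 2 * ((a + b) / 2) powr \<beta> - a powr \<beta> - b powr \<beta>" by simp
  moreover have "(2::real) powr (1 - \<beta>) \<le> 2 powr 1" using \<beta> by (intro powr_mono) auto
  then have "2 powr (1 - \<beta>) * h powr (2 * \<alpha> * \<beta>) \<le> 2 * h powr (2 * \<alpha> * \<beta>)" by (intro mult_right_mono) auto
  ultimately show ?thesis using incr_cov_diag[OF assms] by (simp add: a_def b_def)
qed

text \<open>Two mean value steps turn the second difference into
  \<open>d\<^sup>2 * \<beta> * (1 - \<beta>) * w powr (\<beta> - 2)\<close> with
  \<open>w > a\<close>; for \<open>a \<ge> 1 / 4\<close> the last power is at most
  \<open>4\<^sup>2 = 16\<close>.\<close>

lemma powr_concavity_defect_le:
  fixes a d :: real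
  assumes a: "1 / 4 \<le> a" and d: "0 < d"
  shows "2 * (a + d) powr \<beta> - a powr \<beta> - (a + 2 * d) powr \<beta> \<le> 16 * d\<^sup>2"
proof -
  have "\<exists>z. a < z \<and> z < a + d \<and> ((a + d + d) powr \<beta> - (a + d) powr \<beta>) - ((a + d) powr \<beta> - a powr \<beta>)
      = (a + d - a) * (\<beta> * (z + d) powr (\<beta> - 1) - \<beta> * z powr (\<beta> - 1))"
    by (rule MVT2[where f = "\<lambda>z. (z + d) powr \<beta> - z powr \<beta>"])
       (use a d in \<open>auto intro!: derivative_eq_intros\<close>)
  then obtain z where z: "a < z" "(a + d + d) powr \<beta> - (a + d) powr \<beta> - ((a + d) powr \<beta> - a powr \<beta>)
      = d * (\<beta> * (z + d) powr (\<beta> - 1) - \<beta> * z powr (\<beta> - 1))" by auto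
  have "\<exists>w. z < w \<and> w < z + d \<and> (z + d) powr (\<beta> - 1) - z powr (\<beta> - 1)
      = (z + d - z) * ((\<beta> - 1) * w powr (\<beta> - 1 - 1))"
    by (rule MVT2[where f = "\<lambda>z. z powr (\<beta> - 1)"])
       (use a d z in \<open>auto intro!: derivative_eq_intros\<close>)
  then obtain w where w: "z < w" "(z + d) powr (\<beta> - 1) - z powr (\<beta> - 1) = d * ((\<beta> - 1) * w powr (\<beta> - 2))"
    by auto
  have "w powr (\<beta> - 2) \<le> (1 / 4) powr (\<beta> - 2)" using a z w \<beta> by (intro powr_mono2') auto
  also have "\<dots> \<le> (1 / 4) powr (- 2)" using \<beta> by (intro powr_mono') auto
  also have "\<dots> = 16" by (simp add: powr_minus powr_numeral power2_eq_square)
  finally have w16: "w powr (\<beta> - 2) \<le> 16" .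
  have "2 * (a + d) powr \<beta> - a powr \<beta> - (a + 2 * d) powr \<beta>
      = - (d * \<beta> * ((z + d) powr (\<beta> - 1) - z powr (\<beta> - 1)))"
    using z(2) by (simp add: algebra_simps)
  also have "\<dots> = d\<^sup>2 * (\<beta> * (1 - \<beta>) * w powr (\<beta> - 2))"
    unfolding w(2) by (simp add: power2_eq_square algebra_simps)
  also have "\<dots> \<le> d\<^sup>2 * (1 * 16)"
    using w16 \<beta> by (intro mult_left_mono mult_mono mult_le_one) auto
  finally show ?thesis by simp
qed

text \<open>Away from time 0 the defect is of order \<open>d\<^sup>2\<close> with \<open>d\<close>
  of order \<open>h powr min 1 (2 * \<alpha>)\<close>, which is negligible against
  \<open>h powr (2 * \<alpha> * \<beta>)\<close> for small \<open>h\<close>.\<close>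

lemma incr_cov_diag_ge:
  obtains h0 where "0 < h0" "\<And>x h. \<lbrakk>1 / 2 \<le> x; x + h \<le> 1; 0 < h; h \<le> h0\<rbrakk>
    \<Longrightarrow> h powr (2 * \<alpha> * \<beta>) / 2 \<le> incr_cov h x x"
proof -
  define k where "k = min 1 (2 * \<alpha>)"
  \<comment> \<open>The surplus of the order of the defect over that of the main term.\<close>
  define \<epsilon> where "\<epsilon> = 2 * k - 2 * \<alpha> * \<beta>"
  have "\<alpha> * \<beta> \<le> \<alpha>" using \<alpha> \<beta> by (simp add: mult_left_le)
  then have "\<epsilon> > 0" using \<alpha> unfolding \<epsilon>_def k_def by linarith
  \<comment> \<open>For \<open>h \<le> h0\<close> the defect is at most
    \<open>16 * 4 / 128 = 1 / 2\<close> times the power of \<open>h\<close>, while the main term has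
    coefficient at least 1.\<close>
  define h0 where "h0 = (1 / 128 :: real) powr (1 / \<epsilon>)"
  have "h0 > 0" by (simp add: h0_def)
  moreover have "h powr (2 * \<alpha> * \<beta>) / 2 \<le> incr_cov h x x"
    if x: "1 / 2 \<le> x" "x + h \<le> 1" and h: "0 < h" "h \<le> h0" for x h
  proof -
    define a where "a = x powr (2 * \<alpha>)"
    define d where "d = ((x + h) powr (2 * \<alpha>) - x powr (2 * \<alpha>)) / 2"
    have "(1 / 2) powr 2 \<le> (1 / 2) powr (2 * \<alpha>)" using \<alpha> by (intro powr_mono') auto
    also have "\<dots> \<le> a" unfolding a_def using x \<alpha> by (intro powr_mono2) auto
    finally have a: "1 / 4 \<le> a" by (simp add: power2_eq_square)
    have d: "0 < d" unfolding d_def using x h \<alpha> by (simp add: powr_less_mono2)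
    have "d \<le> 2 * h powr k" using powr_diff_le[of "2 * \<alpha>" x "x + h"] \<alpha> x h by (simp add: d_def k_def)
    then have "d\<^sup>2 \<le> (2 * h powr k)\<^sup>2" using d by (intro power_mono) auto
    also have "\<dots> = 4 * h powr (2 * k)" by (simp add: power_mult_distrib power2_eq_square flip: powr_add)
    also have "h powr (2 * k) = h powr \<epsilon> * h powr (2 * \<alpha> * \<beta>)" by (simp add: \<epsilon>_def flip: powr_add)
    finally have d1: "d\<^sup>2 \<le> 4 * (h powr \<epsilon> * h powr (2 * \<alpha> * \<beta>))" .
    have "h powr \<epsilon> \<le> h0 powr \<epsilon>" using h \<open>\<epsilon> > 0\<close> by (intro powr_mono2) auto
    also have "h0 powr \<epsilon> = 1 / 128" using \<open>\<epsilon> > 0\<close> by (simp add: h0_def powr_powr)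
    finally have "h powr \<epsilon> * h powr (2 * \<alpha> * \<beta>) \<le> 1 / 128 * h powr (2 * \<alpha> * \<beta>)"
      by (rule mult_right_mono) simp
    with d1 have d2: "d\<^sup>2 \<le> 4 * (1 / 128 * h powr (2 * \<alpha> * \<beta>))" by linarith
    have eqs: "(a + (x + h) powr (2 * \<alpha>)) / 2 = a + d" "(x + h) powr (2 * \<alpha>) = a + 2 * d"
      by (simp_all add: a_def d_def field_simps)
    have "incr_cov h x x = 2 powr (1 - \<beta>) * h powr (2 * \<alpha> * \<beta>) - (2 * (a + d) powr \<beta> - a powr \<beta> - (a + 2 * d) powr \<beta>)"
      using incr_cov_diag[of x h] x h unfolding a_def[symmetric] eqs(1) unfolding eqs(2) by simp
    moreover have "1 * h powr (2 * \<alpha> * \<beta>) \<le> 2 powr (1 - \<beta>) * h powr (2 * \<alpha> * \<beta>)"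
      using \<beta> ge_one_powr_ge_zero[of 2 "1 - \<beta>"] by (intro mult_right_mono) auto
    ultimately show ?thesis using powr_concavity_defect_le[OF a d] d2 by linarith
  qed
  ultimately show thesis using that by blast
qed

end

subsection \<open>Integrals of random processes\<close>

text \<open>Time is rounded down to the grid of mesh \<open>1 / 2 ^ n\<close>; the rounded process
  takes countably many time values, hence is jointly measurable, and it converges pointwise by
  continuity of the paths.\<close>

lemma borel_measurable_continuous_process:
  fixes W :: "real \<Rightarrow> 'a \<Rightarrow> real"
  assumes meas: "\<And>x. W x \<in> borel_measurable M"
    and cont: "\<And>\<omega>. \<omega> \<in> space M \<Longrightarrow> continuous_on UNIV (\<lambda>x. W x \<omega>)"
  shows "(\<lambda>(x, \<omega>). W x \<omega>) \<in> borel_measurable (borel \<Otimes>\<^sub>M M)"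
proof (rule borel_measurable_LIMSEQ_real)
  define r where "r n x = real_of_int \<lfloor>x * 2 ^ n\<rfloor> / 2 ^ n" for n :: nat and x :: real
  have r: "(\<lambda>n. r n x) \<longlonglongrightarrow> x" for x
  proof (rule tendsto_sandwich)
    have "(\<lambda>n. x - (1 / 2) ^ n) \<longlonglongrightarrow> x - 0"
      by (intro tendsto_intros LIMSEQ_realpow_zero) auto
    then show "(\<lambda>n. x - 1 / 2 ^ n) \<longlonglongrightarrow> x" by (simp add: power_divide)
    show "(\<lambda>n. x) \<longlonglongrightarrow> x" by simp
    have "x - 1 / 2 ^ n \<le> r n x" "r n x \<le> x" for n
    proof -
      have "(x * 2 ^ n - 1) / 2 ^ n \<le> r n x"
        unfolding r_def using floor_correct[of "x * 2 ^ n"] by (intro divide_right_mono) auto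
      then show "x - 1 / 2 ^ n \<le> r n x" by (simp add: diff_divide_distrib)
      show "r n x \<le> x" unfolding r_def by (simp add: divide_le_eq)
    qed
    then show "\<forall>\<^sub>F n in sequentially. x - 1 / 2 ^ n \<le> r n x" "\<forall>\<^sub>F n in sequentially. r n x \<le> x"
      by simp_all
  qed
  show "(\<lambda>n. case z of (x, \<omega>) \<Rightarrow> W (r n x) \<omega>) \<longlonglongrightarrow> (case z of (x, \<omega>) \<Rightarrow> W x \<omega>)"
    if z: "z \<in> space (borel \<Otimes>\<^sub>M M)" for z
  proof (cases z)
    case (Pair x \<omega>)
    then have "\<omega> \<in> space M" using z by (simp add: space_pair_measure)
    then have "(\<lambda>n. W (r n x) \<omega>) \<longlonglongrightarrow> W x \<omega>"
      by (intro continuous_on_tendsto_compose[OF cont r]) auto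
    then show ?thesis by (simp add: Pair)
  qed
  show "(\<lambda>(x, \<omega>). W (r n x) \<omega>) \<in> borel_measurable (borel \<Otimes>\<^sub>M M)" for n
  proof -
    have "(\<lambda>z. (\<lambda>i (x :: real, \<omega>). W (of_int i / 2 ^ n) \<omega>) (\<lfloor>fst z * 2 ^ n\<rfloor> :: int) z)
        \<in> borel_measurable (borel \<Otimes>\<^sub>M M)"
    proof (rule measurable_compose_countable[where f = "\<lambda>i (x :: real, \<omega>). W (real_of_int i / 2 ^ n) \<omega>"])
      fix i :: int
      note meas[measurable]
      show "(\<lambda>(x :: real, \<omega>). W (of_int i / 2 ^ n) \<omega>) \<in> borel_measurable (borel \<Otimes>\<^sub>M M)"
        by measurable
      show "(\<lambda>z. \<lfloor>(fst z :: real) * 2 ^ n\<rfloor>) \<in> borel \<Otimes>\<^sub>M M \<rightarrow>\<^sub>M count_space UNIV"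
        by measurable
    qed
    then show ?thesis by (simp add: r_def split_beta)
  qed
qed

text \<open>The square of the integral is a double integral of \<open>Y x * Y y\<close>, and Fubini
  moves the expectation inside. The uniform second-moment bound \<open>C\<close> only secures joint
  integrability over the finite measure; the estimate itself comes from the kernel
  \<open>k\<close>.\<close>

lemma (in prob_space) square_integral_process_le:
  fixes L :: "'b measure" and Y :: "'b \<Rightarrow> 'a \<Rightarrow> real"
  assumes "finite_measure L"
    and Y: "(\<lambda>(x, \<omega>). Y x \<omega>) \<in> borel_measurable (L \<Otimes>\<^sub>M M)"
    and sq: "\<And>x. x \<in> space L \<Longrightarrow> integrable M (\<lambda>\<omega>. (Y x \<omega>)\<^sup>2)"
      "\<And>x. x \<in> space L \<Longrightarrow> (\<integral>\<omega>. (Y x \<omega>)\<^sup>2 \<partial>M) \<le> C"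
    and corr: "\<And>x y. x \<in> space L \<Longrightarrow> y \<in> space L \<Longrightarrow> (\<integral>\<omega>. Y x \<omega> * Y y \<omega> \<partial>M) \<le> k x y"
    and k: "integrable (L \<Otimes>\<^sub>M L) (\<lambda>(x, y). k x y)"
  shows "integrable M (\<lambda>\<omega>. (\<integral>x. Y x \<omega> \<partial>L)\<^sup>2)"
    and "(\<integral>\<omega>. (\<integral>x. Y x \<omega> \<partial>L)\<^sup>2 \<partial>M) \<le> (\<integral>x. (\<integral>y. k x y \<partial>L) \<partial>L)"
proof -
  interpret L: finite_measure L by fact
  interpret LL: pair_sigma_finite L L ..
  interpret LL: finite_measure "L \<Otimes>\<^sub>M L" by (rule finite_measure_pair_measure) unfold_locales
  interpret P: pair_sigma_finite "L \<Otimes>\<^sub>M L" M ..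
  note Y[measurable]
  have Yx: "Y x \<in> borel_measurable M" if "x \<in> space L" for x
    using measurable_compose[OF measurable_Pair1'[OF that] Y] by simp
  define G where "G z \<omega> = Y (fst z) \<omega> * Y (snd z) \<omega>" for z \<omega>
  have G[measurable]: "(\<lambda>(z, \<omega>). G z \<omega>) \<in> borel_measurable ((L \<Otimes>\<^sub>M L) \<Otimes>\<^sub>M M)"
    unfolding G_def by measurable
  have Gz: "integrable M (G z) \<and> (\<integral>\<omega>. \<bar>G z \<omega>\<bar> \<partial>M) \<le> C" if "z \<in> space (L \<Otimes>\<^sub>M L)" for z
  proof -
    have z: "fst z \<in> space L" "snd z \<in> space L" using that by (auto simp: space_pair_measure)
    have le: "\<bar>G z \<omega>\<bar> \<le> ((Y (fst z) \<omega>)\<^sup>2 + (Y (snd z) \<omega>)\<^sup>2) / 2" for \<omega>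
      using sum_squares_bound[of "\<bar>Y (fst z) \<omega>\<bar>" "\<bar>Y (snd z) \<omega>\<bar>"] by (simp add: G_def abs_mult)
    have i: "integrable M (\<lambda>\<omega>. ((Y (fst z) \<omega>)\<^sup>2 + (Y (snd z) \<omega>)\<^sup>2) / 2)"
      using z sq(1) by auto
    have int: "integrable M (G z)"
      by (rule Bochner_Integration.integrable_bound[OF i])
        (use borel_measurable_times[OF Yx[OF z(1)] Yx[OF z(2)]] le in
          \<open>auto simp: G_def[abs_def] intro: order_trans[OF _ abs_ge_self]\<close>)
    then have "(\<integral>\<omega>. \<bar>G z \<omega>\<bar> \<partial>M) \<le> (\<integral>\<omega>. ((Y (fst z) \<omega>)\<^sup>2 + (Y (snd z) \<omega>)\<^sup>2) / 2 \<partial>M)"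
      by (intro integral_mono le i) auto
    also have "\<dots> = ((\<integral>\<omega>. (Y (fst z) \<omega>)\<^sup>2 \<partial>M) + (\<integral>\<omega>. (Y (snd z) \<omega>)\<^sup>2 \<partial>M)) / 2"
      using z sq(1) by simp
    also have "\<dots> \<le> C" using sq(2)[OF z(1)] sq(2)[OF z(2)] by simp
    finally show ?thesis using int by simp
  qed
  have int: "integrable ((L \<Otimes>\<^sub>M L) \<Otimes>\<^sub>M M) (\<lambda>(z, \<omega>). G z \<omega>)"
  proof (rule P.Fubini_integrable[OF G])
    show "AE z in L \<Otimes>\<^sub>M L. integrable M (\<lambda>\<omega>. case (z, \<omega>) of (z, \<omega>) \<Rightarrow> G z \<omega>)"
      using Gz by (intro AE_I2) simp
    show "integrable (L \<Otimes>\<^sub>M L) (\<lambda>z. \<integral>\<omega>. norm (case (z, \<omega>) of (z, \<omega>) \<Rightarrow> G z \<omega>) \<partial>M)"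
    proof (rule LL.integrable_const_bound[where B = C])
      show "AE z in L \<Otimes>\<^sub>M L. norm (\<integral>\<omega>. norm (case (z, \<omega>) of (z, \<omega>) \<Rightarrow> G z \<omega>) \<partial>M) \<le> C"
        using Gz by (intro AE_I2) simp
    qed simp
  qed
  have "AE \<omega> in M. integrable (L \<Otimes>\<^sub>M L) (\<lambda>z. G z \<omega>)"
    using P.AE_integrable_snd[OF int] .
  then have ae: "AE \<omega> in M. (\<integral>z. G z \<omega> \<partial>(L \<Otimes>\<^sub>M L)) = (\<integral>x. Y x \<omega> \<partial>L)\<^sup>2"
  proof eventually_elim
    case (elim \<omega>)
    have "(\<integral>z. G z \<omega> \<partial>(L \<Otimes>\<^sub>M L)) = (\<integral>x. (\<integral>y. G (x, y) \<omega> \<partial>L) \<partial>L)"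
      by (rule LL.integral_fst'[symmetric]) (use elim in simp)
    then show ?case by (simp add: G_def power2_eq_square)
  qed
  have i: "integrable M (\<lambda>\<omega>. \<integral>z. G z \<omega> \<partial>(L \<Otimes>\<^sub>M L))"
    using P.integrable_snd[OF int] .
  have m: "(\<lambda>\<omega>. (\<integral>x. Y x \<omega> \<partial>L)\<^sup>2) \<in> borel_measurable M" by measurable
  show "integrable M (\<lambda>\<omega>. (\<integral>x. Y x \<omega> \<partial>L)\<^sup>2)"
    using i integrable_cong_AE[OF borel_measurable_integrable[OF i] m ae] by blast
  have "(\<integral>\<omega>. (\<integral>x. Y x \<omega> \<partial>L)\<^sup>2 \<partial>M) = (\<integral>\<omega>. (\<integral>z. G z \<omega> \<partial>(L \<Otimes>\<^sub>M L)) \<partial>M)"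
    by (rule integral_cong_AE[OF m borel_measurable_integrable[OF i]]) (use ae in auto)
  also have "\<dots> = (\<integral>z. (\<integral>\<omega>. G z \<omega> \<partial>M) \<partial>(L \<Otimes>\<^sub>M L))"
    by (rule P.Fubini_integral[OF int])
  also have "\<dots> \<le> (\<integral>z. (case z of (x, y) \<Rightarrow> k x y) \<partial>(L \<Otimes>\<^sub>M L))"
  proof (rule integral_mono[OF _ k])
    show "integrable (L \<Otimes>\<^sub>M L) (\<lambda>z. \<integral>\<omega>. G z \<omega> \<partial>M)"
      using P.integrable_fst'[OF int] by simp
    show "(\<integral>\<omega>. G z \<omega> \<partial>M) \<le> (case z of (x, y) \<Rightarrow> k x y)" if "z \<in> space (L \<Otimes>\<^sub>M L)" for z
      using corr that by (auto simp: G_def space_pair_measure)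
  qed
  also have "\<dots> = (\<integral>x. (\<integral>y. k x y \<partial>L) \<partial>L)"
    using LL.integral_fst'[OF k] by simp
  finally show "(\<integral>\<omega>. (\<integral>x. Y x \<omega> \<partial>L)\<^sup>2 \<partial>M) \<le> (\<integral>x. (\<integral>y. k x y \<partial>L) \<partial>L)" .
qed

text \<open>The sum of the squares has finite expectation, so it is almost surely finite and its
  terms tend to zero.\<close>

lemma AE_LIMSEQ_0_if_summable_square:
  fixes Q :: "nat \<Rightarrow> 'a \<Rightarrow> real"
  assumes [measurable]: "\<And>j. Q j \<in> borel_measurable M"
    and int: "\<And>j. integrable M (\<lambda>\<omega>. (Q j \<omega>)\<^sup>2)"
    and le: "\<And>j. (\<integral>\<omega>. (Q j \<omega>)\<^sup>2 \<partial>M) \<le> a j" and a: "summable a"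
  shows "AE \<omega> in M. (\<lambda>j. Q j \<omega>) \<longlonglongrightarrow> 0"
proof -
  have a0: "0 \<le> a j" for j by (rule order_trans[OF _ le[of j]]) simp
  have "(\<integral>\<^sup>+\<omega>. (\<Sum>j. ennreal ((Q j \<omega>)\<^sup>2)) \<partial>M) = (\<Sum>j. \<integral>\<^sup>+\<omega>. ennreal ((Q j \<omega>)\<^sup>2) \<partial>M)"
    by (rule nn_integral_suminf) measurable
  also have "\<dots> \<le> (\<Sum>j. ennreal (a j))"
    using le int by (intro suminf_le) (auto simp: nn_integral_eq_integral intro!: ennreal_leI)
  also have "\<dots> = ennreal (\<Sum>j. a j)" using a0 a by (rule suminf_ennreal2)
  also have "\<dots> < \<infinity>" by simp
  finally have "AE \<omega> in M. (\<Sum>j. ennreal ((Q j \<omega>)\<^sup>2)) \<noteq> \<infinity>"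
    by (intro nn_integral_PInf_AE) auto
  then show ?thesis
  proof eventually_elim
    case (elim \<omega>)
    then have "summable (\<lambda>j. (Q j \<omega>)\<^sup>2)" by (intro summable_suminf_not_top) auto
    then have "(\<lambda>j. (Q j \<omega>)\<^sup>2) \<longlonglongrightarrow> 0" by (rule summable_LIMSEQ_zero)
    then have "(\<lambda>j. sqrt ((Q j \<omega>)\<^sup>2)) \<longlonglongrightarrow> sqrt 0" by (rule tendsto_real_sqrt)
    then show ?case by (simp add: tendsto_rabs_zero_iff)
  qed
qed

text \<open>Bridge between the two integrals in use: Bochner integrals for probability and Fubini,
  gauge integrals for the telescoping estimates.\<close>

lemma integral_restrict_Icc:
  fixes f :: "real \<Rightarrow> real"
  assumes "integrable (restrict_space lborel {a..b}) f"
  shows "integral\<^sup>L (restrict_space lborel {a..b}) f = integral {a..b} f"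
proof -
  have "set_integrable lborel {a..b} f"
    using assms unfolding set_integrable_def by (subst (asm) integrable_restrict_space) auto
  then show ?thesis
    using set_borel_integral_eq_integral(2)[of "{a..b}" f]
    by (simp add: integral_restrict_space set_lebesgue_integral_def)
qed

subsection \<open>Bifractional Brownian paths\<close>

locale bifractional_path =
  fixes M :: "'a measure" and B :: "real \<Rightarrow> 'a \<Rightarrow> real" and \<alpha> \<beta> :: real
  assumes \<alpha>: "0 < \<alpha>" "\<alpha> < 1" and \<beta>: "0 < \<beta>" "\<beta> \<le> 1"
    and bbm: "bifractional_brownian_motion M {0..1} \<alpha> \<beta> B"
begin

sublocale prob_space M
  using bbm by (simp add: bifractional_brownian_motion_def)

lemma gaussian_rv_sum:
  assumes "finite J" "J \<subseteq> {0..1}"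
  shows "gaussian_rv M (\<lambda>\<omega>. \<Sum>t\<in>J. c t * B t \<omega>)"
  using bbm assms by (simp add: bifractional_brownian_motion_def gaussian_process_def)

lemma gaussian_rv_B: "t \<in> {0..1} \<Longrightarrow> gaussian_rv M (B t)"
  using gaussian_rv_sum[of "{t}" "\<lambda>_. 1"] by simp

lemma B_measurable: "t \<in> {0..1} \<Longrightarrow> B t \<in> borel_measurable M"
  using gaussian_rv_B by (simp add: gaussian_rv_def)

lemma continuous_on_B: "\<omega> \<in> space M \<Longrightarrow> continuous_on {0..1} (\<lambda>t. B t \<omega>)"
  using bbm by (simp add: bifractional_brownian_motion_def)

lemma expectation_B: "t \<in> {0..1} \<Longrightarrow> expectation (B t) = 0"
  using bbm by (simp add: bifractional_brownian_motion_def)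

lemma integrable_B_power: "t \<in> {0..1} \<Longrightarrow> integrable M (\<lambda>\<omega>. B t \<omega> ^ n)"
  by (rule integrable_power_gaussian_rv[OF prob_space_axioms gaussian_rv_B expectation_B])

lemma integrable_B_mult:
  assumes "s \<in> {0..1}" "t \<in> {0..1}"
  shows "integrable M (\<lambda>\<omega>. B s \<omega> * B t \<omega>)"
proof (rule Bochner_Integration.integrable_bound)
  show "integrable M (\<lambda>\<omega>. B s \<omega> ^ 2 + B t \<omega> ^ 2)"
    using assms by (intro Bochner_Integration.integrable_add integrable_B_power)
  show "AE \<omega> in M. norm (B s \<omega> * B t \<omega>) \<le> norm (B s \<omega> ^ 2 + B t \<omega> ^ 2)"
  proof (rule AE_I2)
    fix \<omega>
    have "2 * (\<bar>B s \<omega>\<bar> * \<bar>B t \<omega>\<bar>) \<le> B s \<omega> ^ 2 + B t \<omega> ^ 2"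
      using sum_squares_bound[of "\<bar>B s \<omega>\<bar>" "\<bar>B t \<omega>\<bar>"] by simp
    moreover have "0 \<le> \<bar>B s \<omega>\<bar> * \<bar>B t \<omega>\<bar>" by simp
    ultimately show "norm (B s \<omega> * B t \<omega>) \<le> norm (B s \<omega> ^ 2 + B t \<omega> ^ 2)"
      unfolding real_norm_def abs_mult by linarith
  qed
qed (use assms B_measurable in \<open>auto intro!: borel_measurable_times\<close>)

lemma expectation_B_mult:
  assumes "s \<in> {0..1}" "t \<in> {0..1}"
  shows "expectation (\<lambda>\<omega>. B s \<omega> * B t \<omega>) = bifractional_cov \<alpha> \<beta> s t"
proof -
  have "covariance M (B s) (B t) = bifractional_cov \<alpha> \<beta> s t"
    using bbm assms by (simp add: bifractional_brownian_motion_def)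
  then show ?thesis using assms by (simp add: covariance_def expectation_B)
qed

lemma gaussian_rv_increments:
  assumes "s \<in> {0..1}" "s' \<in> {0..1}" "t \<in> {0..1}" "t' \<in> {0..1}"
  shows "gaussian_rv M (\<lambda>\<omega>. a * (B s' \<omega> - B s \<omega>) + b * (B t' \<omega> - B t \<omega>))"
proof -
  \<comment> \<open>The four times may coincide, and the process condition speaks of sums over sets;
    adding up indicators gives the right coefficient in every case.\<close>
  define c where "c u = a * of_bool (u = s') - a * of_bool (u = s) + b * of_bool (u = t') - b * of_bool (u = t)" for u
  have pick: "(\<Sum>u\<in>{s, s', t, t'}. of_bool (u = v) * B u \<omega>) = B v \<omega>" if "v \<in> {s, s', t, t'}" for v \<omega>
    using that by (subst sum.remove[OF _ that]) auto
  have "(\<Sum>u\<in>{s, s', t, t'}. c u * B u \<omega>) =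
      a * (\<Sum>u\<in>{s, s', t, t'}. of_bool (u = s') * B u \<omega>) - a * (\<Sum>u\<in>{s, s', t, t'}. of_bool (u = s) * B u \<omega>)
      + b * (\<Sum>u\<in>{s, s', t, t'}. of_bool (u = t') * B u \<omega>) - b * (\<Sum>u\<in>{s, s', t, t'}. of_bool (u = t) * B u \<omega>)" for \<omega>
    unfolding sum_distrib_left sum_subtractf[symmetric] sum.distrib[symmetric]
    by (intro sum.cong refl) (simp add: c_def algebra_simps)
  then have "(\<Sum>u\<in>{s, s', t, t'}. c u * B u \<omega>) = a * (B s' \<omega> - B s \<omega>) + b * (B t' \<omega> - B t \<omega>)" for \<omega>
    by (simp only: pick insertI1 insertI2) (simp add: algebra_simps)
  then show ?thesis using gaussian_rv_sum[of "{s, s', t, t'}" c] assms by simp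
qed

lemma expectation_increment_mult:
  assumes "0 \<le> h" "x \<in> {0..1 - h}" "y \<in> {0..1 - h}"
  shows "expectation (\<lambda>\<omega>. (B (x + h) \<omega> - B x \<omega>) * (B (y + h) \<omega> - B y \<omega>)) = incr_cov \<alpha> \<beta> h x y"
proof -
  have m: "x \<in> {0..1}" "y \<in> {0..1}" "x + h \<in> {0..1}" "y + h \<in> {0..1}" using assms by auto
  note i = integrable_B_mult[OF m(3) m(4)] integrable_B_mult[OF m(3) m(2)]
    integrable_B_mult[OF m(1) m(4)] integrable_B_mult[OF m(1) m(2)]
  have "expectation (\<lambda>\<omega>. (B (x + h) \<omega> - B x \<omega>) * (B (y + h) \<omega> - B y \<omega>)) =
     expectation (\<lambda>\<omega>. B (x + h) \<omega> * B (y + h) \<omega> - B (x + h) \<omega> * B y \<omega> - B x \<omega> * B (y + h) \<omega> + B x \<omega> * B y \<omega>)"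
    by (simp add: algebra_simps)
  also have "\<dots> = incr_cov \<alpha> \<beta> h x y"
    using i by (simp add: incr_cov_def[OF \<alpha> \<beta>] expectation_B_mult[OF m(3) m(4)]
        expectation_B_mult[OF m(3) m(2)] expectation_B_mult[OF m(1) m(4)] expectation_B_mult[OF m(1) m(2)])
  finally show ?thesis .
qed

text \<open>The constant extension of a path beyond the unit interval is continuous on the whole line, which
  makes the process jointly measurable.\<close>

definition clamped :: "real \<Rightarrow> 'a \<Rightarrow> real" where
  "clamped t \<omega> = B (max 0 (min 1 t)) \<omega>"

lemma clamped_eq: "t \<in> {0..1} \<Longrightarrow> clamped t \<omega> = B t \<omega>"
  by (simp add: clamped_def)

lemma clamped_measurable [measurable]:
  "(\<lambda>(t, \<omega>). clamped t \<omega>) \<in> borel_measurable (borel \<Otimes>\<^sub>M M)"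
proof (rule borel_measurable_continuous_process)
  show "clamped t \<in> borel_measurable M" for t
    unfolding clamped_def[abs_def] by (rule B_measurable) auto
  show "continuous_on UNIV (\<lambda>t. clamped t \<omega>)" if "\<omega> \<in> space M" for \<omega>
    unfolding clamped_def
    by (rule continuous_on_compose2[OF continuous_on_B[OF that]]) (auto intro!: continuous_intros)
qed

section \<open>Increments over dyadic steps, normalised to bounded variance\<close>

definition Z :: "nat \<Rightarrow> real \<Rightarrow> 'a \<Rightarrow> real" where
  "Z j x \<omega> = (2 powr (\<alpha> * \<beta>)) ^ j * (clamped (x + 1 / 2 ^ j) \<omega> - clamped x \<omega>)"

text \<open>Lebesgue measure on the starting points from which a step of length
  \<open>1 / 2 ^ j\<close> stays in the unit interval. For \<open>j = 0\<close> this is the zero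
  measure on a single point.\<close>

definition L :: "nat \<Rightarrow> real measure" where
  "L j = restrict_space lborel {0..1 - 1 / 2 ^ j}"

definition v :: "nat \<Rightarrow> real \<Rightarrow> real \<Rightarrow> real" where
  "v j x y = (2 powr (2 * \<alpha> * \<beta>)) ^ j * incr_cov \<alpha> \<beta> (1 / 2 ^ j) x y"

lemma step_le_1: "1 / 2 ^ j \<le> (1 :: real)" by simp

lemma space_L: "space (L j) = {0..1 - 1 / 2 ^ j}"
  by (simp add: L_def)

lemma measure_L: "measure (L j) (space (L j)) = 1 - 1 / 2 ^ j"
  unfolding space_L unfolding L_def
  by (subst measure_restrict_space) (auto simp: step_le_1)

lemma finite_measure_L: "finite_measure (L j)"
  unfolding L_def by (rule finite_measureI) (simp add: emeasure_restrict_space emeasure_lborel_Icc_eq)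

lemma measurable_ident_L [measurable]: "(\<lambda>x. x) \<in> L j \<rightarrow>\<^sub>M borel"
  unfolding L_def by (intro measurable_restrict_space1) simp

lemma Z_measurable [measurable]: "(\<lambda>(x, \<omega>). Z j x \<omega>) \<in> borel_measurable (L j \<Otimes>\<^sub>M M)"
proof -
  have [measurable]: "fst \<in> L j \<Otimes>\<^sub>M M \<rightarrow>\<^sub>M borel"
    using measurable_compose[OF measurable_fst measurable_ident_L] by simp
  have "(\<lambda>z. (2 powr (\<alpha> * \<beta>)) ^ j * ((\<lambda>(t, \<omega>). clamped t \<omega>) (fst z + 1 / 2 ^ j, snd z)
      - (\<lambda>(t, \<omega>). clamped t \<omega>) (fst z, snd z))) \<in> borel_measurable (L j \<Otimes>\<^sub>M M)"
    by measurable
  then show ?thesis by (simp add: Z_def split_beta)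
qed

lemma step_in_unit:
  assumes "x \<in> space (L j)"
  shows "x \<in> {0..1}" "x + 1 / 2 ^ j \<in> {0..1}"
proof -
  have "0 \<le> 1 / (2 :: real) ^ j" by simp
  then show "x \<in> {0..1}" "x + 1 / 2 ^ j \<in> {0..1}"
    using assms unfolding space_L atLeastAtMost_iff by linarith+
qed

lemma Z_eq:
  assumes "x \<in> space (L j)"
  shows "Z j x = (\<lambda>\<omega>. (2 powr (\<alpha> * \<beta>)) ^ j * (B (x + 1 / 2 ^ j) \<omega> - B x \<omega>))"
  unfolding Z_def[abs_def] using step_in_unit[OF assms] by (simp add: clamped_eq)

lemma gaussian_rv_Z:
  assumes "x \<in> space (L j)" "y \<in> space (L j)"
  shows "gaussian_rv M (\<lambda>\<omega>. a * Z j x \<omega> + b * Z j y \<omega>)"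
  using gaussian_rv_increments[OF step_in_unit[OF assms(1)] step_in_unit[OF assms(2)],
      of "a * (2 powr (\<alpha> * \<beta>)) ^ j" "b * (2 powr (\<alpha> * \<beta>)) ^ j"] assms
  by (simp add: Z_eq mult.assoc)

lemma expectation_Z:
  assumes "x \<in> space (L j)"
  shows "expectation (Z j x) = 0"
proof -
  note m = step_in_unit[OF assms]
  have "integrable M (B x)" "integrable M (B (x + 1 / 2 ^ j))"
    using integrable_B_power[OF m(1), of 1] integrable_B_power[OF m(2), of 1] by auto
  then show ?thesis by (simp add: Z_eq[OF assms] expectation_B[OF m(1)] expectation_B[OF m(2)])
qed

lemma expectation_Z_mult:
  assumes "x \<in> space (L j)" "y \<in> space (L j)"
  shows "expectation (\<lambda>\<omega>. Z j x \<omega> * Z j y \<omega>) = v j x y"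
proof -
  have "(2 powr (2 * \<alpha> * \<beta>)) ^ j = (2 powr (\<alpha> * \<beta>)) ^ j * (2 powr (\<alpha> * \<beta>)) ^ j"
    by (simp add: mult.assoc flip: power_mult_distrib powr_add)
  then have "expectation (\<lambda>\<omega>. Z j x \<omega> * Z j y \<omega>) = (2 powr (2 * \<alpha> * \<beta>)) ^ j *
      expectation (\<lambda>\<omega>. (B (x + 1 / 2 ^ j) \<omega> - B x \<omega>) * (B (y + 1 / 2 ^ j) \<omega> - B y \<omega>))"
    using assms by (simp add: Z_eq mult_ac flip: integral_mult_right_zero)
  then show ?thesis
    using expectation_increment_mult[of "1 / 2 ^ j" x y] assms by (simp add: v_def space_L)
qed

lemma expectation_Z_square: "x \<in> space (L j) \<Longrightarrow> expectation (\<lambda>\<omega>. (Z j x \<omega>)\<^sup>2) = v j x x"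
  using expectation_Z_mult[of x j x] by (simp add: power2_eq_square)

lemma scale_step: "(2 powr (2 * \<alpha> * \<beta>)) ^ j * (1 / 2 ^ j) powr (2 * \<alpha> * \<beta>) = 1"
  using powr_scale_dyadic[of "2 * \<alpha>" \<beta> j] powr_dyadic[of j "2 * \<alpha> * \<beta>"] by simp

lemma v_nonneg: "x \<in> space (L j) \<Longrightarrow> 0 \<le> v j x x"
  using expectation_Z_square[of x j, symmetric] by simp

text \<open>Provides the variance bound 2 under which the covariance estimate for Gaussian pairs is
  uniform.\<close>

lemma v_le_2:
  assumes "x \<in> space (L j)"
  shows "v j x x \<le> 2"
proof -
  have "v j x x \<le> (2 powr (2 * \<alpha> * \<beta>)) ^ j * (2 * (1 / 2 ^ j) powr (2 * \<alpha> * \<beta>))"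
    unfolding v_def using incr_cov_diag_le[OF \<alpha> \<beta>, of x "1 / 2 ^ j"] assms
    by (intro mult_left_mono) (auto simp: space_L)
  also have "\<dots> = 2" using scale_step[of j] by (simp add: mult_ac)
  finally show ?thesis .
qed

text \<open>The \<open>2 * m\<close>-th moment of a standard normal variable,
  \<open>(2 * m - 1)!!\<close>.\<close>

definition mom :: "nat \<Rightarrow> real" where "mom m = fact (2 * m) / (2 ^ m * fact m)"

lemma mom_nonneg: "0 \<le> mom m" by (simp add: mom_def)

lemma integrable_Z_power: "x \<in> space (L j) \<Longrightarrow> integrable M (\<lambda>\<omega>. Z j x \<omega> ^ n)"
  using integrable_power_gaussian_rv[OF prob_space_axioms _ expectation_Z] gaussian_rv_Z[of x j x 1 0]
  by simp

lemma expectation_Z_even_power: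
  "x \<in> space (L j) \<Longrightarrow> expectation (\<lambda>\<omega>. Z j x \<omega> ^ (2 * m)) = mom m * v j x x ^ m"
  using even_moment_gaussian_rv[OF prob_space_axioms _ expectation_Z] gaussian_rv_Z[of x j x 1 0]
  by (simp add: expectation_Z_square mom_def)

lemma v_diag_measurable [measurable]: "(\<lambda>x. v j x x) \<in> borel_measurable (L j)"
  unfolding v_def incr_cov_def[OF \<alpha> \<beta>] bifractional_cov_def by measurable

section \<open>Law of large numbers for even powers\<close>

definition X :: "nat \<Rightarrow> nat \<Rightarrow> 'a \<Rightarrow> real" where
  "X m j \<omega> = (\<integral>x. Z j x \<omega> ^ (2 * m) \<partial>L j)"

lemma continuous_on_Z:
  assumes "\<omega> \<in> space M"
  shows "continuous_on S (\<lambda>x. Z j x \<omega>)"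
proof -
  have "continuous_on UNIV (\<lambda>t. clamped t \<omega>)"
    unfolding clamped_def
    by (rule continuous_on_compose2[OF continuous_on_B[OF assms]]) (auto intro!: continuous_intros)
  then show ?thesis unfolding Z_def
    by (intro continuous_intros continuous_on_compose2[where f = "\<lambda>x. x + 1 / 2 ^ j" and t = UNIV]
        continuous_on_subset[where s = UNIV and t = S]) (auto intro!: continuous_intros)
qed

lemma integrable_L_continuous:
  assumes "continuous_on {0..1 - 1 / 2 ^ j} (f :: real \<Rightarrow> real)"
  shows "integrable (L j) f"
  using borel_integrable_atLeastAtMost'[OF assms]
  unfolding L_def set_integrable_def by (subst integrable_restrict_space) auto

lemma integrable_L_Z_power: "\<omega> \<in> space M \<Longrightarrow> integrable (L j) (\<lambda>x. Z j x \<omega> ^ n)"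
  by (intro integrable_L_continuous continuous_on_power continuous_on_Z)

lemma integrable_L_mean: "integrable (L j) (\<lambda>x. mom m * v j x x ^ m)"
proof -
  interpret finite_measure "L j" by (rule finite_measure_L)
  show ?thesis
  proof (rule integrable_const_bound[where B = "mom m * 2 ^ m"])
    show "AE x in L j. norm (mom m * v j x x ^ m) \<le> mom m * 2 ^ m"
      using v_le_2 v_nonneg mom_nonneg by (intro AE_I2) (auto intro!: mult_left_mono power_mono)
  qed measurable
qed

text \<open>With \<open>h = 1 / 2 ^ j\<close>, the covariances of the even powers are at most
  \<open>C * h powr (- 2 * \<alpha> * \<beta>)\<close> times \<open>incr_cov_bound\<close>, whose
  double integral is at most \<open>40 * h powr (1 + min 1 (2 * \<alpha> * \<beta>))\<close>; the
  product of the two powers of \<open>h\<close> is the geometric rate.\<close>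

lemma expectation_centred_square_le:
  obtains C where "C \<ge> 0" and "\<And>j. integrable M (\<lambda>\<omega>. (\<integral>x. Z j x \<omega> ^ (2 * m) - mom m * v j x x ^ m \<partial>L j)\<^sup>2) \<and>
    expectation (\<lambda>\<omega>. (\<integral>x. Z j x \<omega> ^ (2 * m) - mom m * v j x x ^ m \<partial>L j)\<^sup>2)
      \<le> C * (2 powr - (1 + min 1 (2 * \<alpha> * \<beta>) - 2 * \<alpha> * \<beta>)) ^ j"
proof -
  obtain C :: real where C: "C \<ge> 0" "\<And>(M :: 'a measure) U V. \<lbrakk>prob_space M;
           \<And>a b. gaussian_rv M (\<lambda>\<omega>. a * U \<omega> + b * V \<omega>);
           (\<integral>\<omega>. U \<omega> \<partial>M) = 0; (\<integral>\<omega>. V \<omega> \<partial>M) = 0;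
           (\<integral>\<omega>. (U \<omega>)\<^sup>2 \<partial>M) \<le> 2; (\<integral>\<omega>. (V \<omega>)\<^sup>2 \<partial>M) \<le> 2\<rbrakk> \<Longrightarrow>
           \<bar>(\<integral>\<omega>. U \<omega> ^ (2 * m) * V \<omega> ^ (2 * m) \<partial>M) - (\<integral>\<omega>. U \<omega> ^ (2 * m) \<partial>M) * (\<integral>\<omega>. V \<omega> ^ (2 * m) \<partial>M)\<bar>
             \<le> C * \<bar>\<integral>\<omega>. U \<omega> * V \<omega> \<partial>M\<bar>"
    using gaussian_pair_even_power_covariance[of m] by blast
  have main: "integrable M (\<lambda>\<omega>. (\<integral>x. Z j x \<omega> ^ (2 * m) - mom m * v j x x ^ m \<partial>L j)\<^sup>2) \<and>
    expectation (\<lambda>\<omega>. (\<integral>x. Z j x \<omega> ^ (2 * m) - mom m * v j x x ^ m \<partial>L j)\<^sup>2)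
      \<le> (40 * C) * (2 powr - (1 + min 1 (2 * \<alpha> * \<beta>) - 2 * \<alpha> * \<beta>)) ^ j" for j
  proof -
    interpret L: finite_measure "L j" by (rule finite_measure_L)
    interpret LL: pair_sigma_finite "L j" "L j" ..
    interpret LL: finite_measure "L j \<Otimes>\<^sub>M L j" by (rule finite_measure_pair_measure) unfold_locales
    define h :: real where "h = 1 / 2 ^ j"
    have h: "0 < h" "h \<le> 1" by (simp_all add: h_def)
    have spL: "space (L j) = {0..1 - h}" by (simp add: space_L h_def)
    define s where "s = (2 powr (2 * \<alpha> * \<beta>)) ^ j"
    define k where "k x y = C * s * incr_cov_bound \<alpha> \<beta> h x y" for x y
    let ?Y = "\<lambda>x \<omega>. Z j x \<omega> ^ (2 * m) - mom m * v j x x ^ m"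
    have sqY: "(?Y x \<omega>)\<^sup>2 = Z j x \<omega> ^ (2 * (2 * m)) - 2 * (mom m * v j x x ^ m) * Z j x \<omega> ^ (2 * m) + (mom m * v j x x ^ m)\<^sup>2" for x \<omega>
    proof -
      have "Z j x \<omega> ^ (2 * (2 * m)) = (Z j x \<omega> ^ (2 * m))\<^sup>2" by (simp add: mult.commute flip: power_mult)
      then show ?thesis by (simp add: power2_diff mult_ac)
    qed
    have iY: "integrable M (\<lambda>\<omega>. ?Y x \<omega> * ?Y y \<omega>) \<and> expectation (\<lambda>\<omega>. ?Y x \<omega> * ?Y y \<omega>) \<le> k x y"
      if xy: "x \<in> space (L j)" "y \<in> space (L j)" for x y
    proof -
      have [measurable]: "Z j x \<in> borel_measurable M" "Z j y \<in> borel_measurable M"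
        using integrable_Z_power[OF xy(1), of 1] integrable_Z_power[OF xy(2), of 1] by auto
      have i: "integrable M (\<lambda>\<omega>. Z j x \<omega> ^ (2 * m) * Z j y \<omega> ^ (2 * m))"
      proof (rule Bochner_Integration.integrable_bound)
        show "integrable M (\<lambda>\<omega>. 1 + Z j x \<omega> ^ (2 * (2 * m + 2 * m)) + Z j y \<omega> ^ (2 * (2 * m + 2 * m)))"
          by (intro Bochner_Integration.integrable_add integrable_Z_power xy) simp
        show "AE \<omega> in M. norm (Z j x \<omega> ^ (2 * m) * Z j y \<omega> ^ (2 * m))
            \<le> norm (1 + Z j x \<omega> ^ (2 * (2 * m + 2 * m)) + Z j y \<omega> ^ (2 * (2 * m + 2 * m)))"
          by (rule AE_I2) (unfold real_norm_def, rule order_trans[OF abs_power_mult_power_le abs_ge_self])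
      qed measurable
      note ii = i integrable_Z_power[OF xy(1), of "2 * m"] integrable_Z_power[OF xy(2), of "2 * m"]
      define a where "a = mom m * v j x x ^ m"
      define b where "b = mom m * v j y y ^ m"
      have ea: "expectation (\<lambda>\<omega>. Z j x \<omega> ^ (2 * m)) = a" "expectation (\<lambda>\<omega>. Z j y \<omega> ^ (2 * m)) = b"
        using xy by (simp_all add: expectation_Z_even_power a_def b_def)
      have eq: "(Z j x \<omega> ^ (2 * m) - a) * (Z j y \<omega> ^ (2 * m) - b) =
          Z j x \<omega> ^ (2 * m) * Z j y \<omega> ^ (2 * m) - b * Z j x \<omega> ^ (2 * m) - a * Z j y \<omega> ^ (2 * m) + a * b" for \<omega>
        by (simp add: algebra_simps)
      have 1: "integrable M (\<lambda>\<omega>. (Z j x \<omega> ^ (2 * m) - a) * (Z j y \<omega> ^ (2 * m) - b))"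
        unfolding eq using ii by (intro Bochner_Integration.integrable_add Bochner_Integration.integrable_diff integrable_mult_right) auto
      have "expectation (\<lambda>\<omega>. (Z j x \<omega> ^ (2 * m) - a) * (Z j y \<omega> ^ (2 * m) - b)) =
          expectation (\<lambda>\<omega>. Z j x \<omega> ^ (2 * m) * Z j y \<omega> ^ (2 * m)) - a * b"
        unfolding eq using ii by (simp add: ea prob_space)
      also have "\<dots> \<le> \<bar>expectation (\<lambda>\<omega>. Z j x \<omega> ^ (2 * m) * Z j y \<omega> ^ (2 * m))
          - expectation (\<lambda>\<omega>. Z j x \<omega> ^ (2 * m)) * expectation (\<lambda>\<omega>. Z j y \<omega> ^ (2 * m))\<bar>"
        unfolding ea by simp
      also have "\<dots> \<le> C * \<bar>expectation (\<lambda>\<omega>. Z j x \<omega> * Z j y \<omega>)\<bar>"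
        using xy v_le_2
        by (intro C(2) prob_space_axioms gaussian_rv_Z expectation_Z) (auto simp: expectation_Z_square)
      also have "\<dots> = C * (s * \<bar>incr_cov \<alpha> \<beta> h x y\<bar>)"
        unfolding expectation_Z_mult[OF xy] by (simp add: v_def s_def h_def abs_mult)
      also have "\<dots> \<le> C * (s * incr_cov_bound \<alpha> \<beta> h x y)"
        using xy h C(1) unfolding spL
        by (intro mult_left_mono abs_incr_cov_le[OF \<alpha> \<beta>]) (auto simp: s_def)
      finally show ?thesis using 1 by (simp add: k_def a_def b_def mult.assoc)
    qed
    have contk: "continuous_on ({0..1 - h} \<times> {0..1 - h}) (\<lambda>(x, y). k x y)"
    proof -
      have "continuous_on ({0..1 - h} \<times> {0..1 - h}) (\<lambda>(x, y). incr_cov_bound \<alpha> \<beta> h x y)"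
        by (rule continuous_on_subset[OF continuous_on_incr_cov_bound[OF \<alpha> \<beta>]]) (use h in auto)
      then show ?thesis unfolding k_def split_beta by (intro continuous_intros)
    qed
    have bndk: "\<exists>D. \<forall>z\<in>{0..1 - h} \<times> {0..1 - h}. \<bar>case z of (x, y) \<Rightarrow> k x y\<bar> \<le> D"
    proof -
      have "bounded ((\<lambda>(x, y). k x y) ` ({0..1 - h} \<times> {0..1 - h}))"
        by (intro compact_imp_bounded compact_continuous_image contk compact_Times) auto
      then show ?thesis unfolding bounded_iff by (metis imageI real_norm_def)
    qed
    then obtain D where D: "\<And>z. z \<in> {0..1 - h} \<times> {0..1 - h} \<Longrightarrow> \<bar>case z of (x, y) \<Rightarrow> k x y\<bar> \<le> D" by blast
    have [measurable]: "fst \<in> L j \<Otimes>\<^sub>M L j \<rightarrow>\<^sub>M borel" "snd \<in> L j \<Otimes>\<^sub>M L j \<rightarrow>\<^sub>M borel"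
      using measurable_compose[OF measurable_fst measurable_ident_L]
        measurable_compose[OF measurable_snd measurable_ident_L] by simp_all
    have mk: "(\<lambda>(x, y). k x y) \<in> borel_measurable (L j \<Otimes>\<^sub>M L j)"
      unfolding k_def incr_cov_bound_def[OF \<alpha> \<beta>] split_beta by measurable
    have ik: "integrable (L j \<Otimes>\<^sub>M L j) (\<lambda>(x, y). k x y)"
      by (rule LL.integrable_const_bound[where B = D, OF _ mk])
        (use D in \<open>auto intro!: AE_I2 simp: space_pair_measure spL\<close>)
    have mY: "(\<lambda>(x, \<omega>). ?Y x \<omega>) \<in> borel_measurable (L j \<Otimes>\<^sub>M M)"
    proof -
      have "(\<lambda>z. v j (fst z) (fst z)) \<in> borel_measurable (L j \<Otimes>\<^sub>M M)"
        using measurable_compose[OF measurable_fst v_diag_measurable] .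
      moreover have "(\<lambda>z. Z j (fst z) (snd z)) \<in> borel_measurable (L j \<Otimes>\<^sub>M M)"
        using Z_measurable[of j] by (simp add: split_beta)
      ultimately show ?thesis unfolding split_beta by measurable
    qed
    \<comment> \<open>On the diagonal the kernel dominates the second moments, so its bound
      \<open>D\<close> also serves as their uniform bound.\<close>
    have sqle: "expectation (\<lambda>\<omega>. (?Y x \<omega>)\<^sup>2) \<le> D" if "x \<in> space (L j)" for x
    proof -
      have "expectation (\<lambda>\<omega>. (?Y x \<omega>)\<^sup>2) \<le> k x x" using iY[OF that that] by (simp add: power2_eq_square)
      also have "k x x \<le> D" using D[of "(x, x)"] that by (simp add: spL)
      finally show ?thesis .
    qed
    have sqi: "integrable M (\<lambda>\<omega>. (?Y x \<omega>)\<^sup>2)" if "x \<in> space (L j)" for x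
      using iY[OF that that] by (simp add: power2_eq_square)
    have corr: "expectation (\<lambda>\<omega>. ?Y x \<omega> * ?Y y \<omega>) \<le> k x y" if "x \<in> space (L j)" "y \<in> space (L j)" for x y
      using iY[OF that] by simp
    note R = square_integral_process_le[OF finite_measure_L mY sqi sqle corr ik]
    have inner: "(\<integral>y. k x y \<partial>L j) = integral {0..1 - h} (k x)" if "x \<in> space (L j)" for x
    proof -
      have "continuous_on {0..1 - h} (\<lambda>y. case (x, y) of (x, y) \<Rightarrow> k x y)"
        by (rule continuous_on_compose2[OF contk])
          (use that in \<open>auto simp: spL intro!: continuous_on_Pair[OF continuous_on_const continuous_on_id]\<close>)
      then have "integrable (L j) (k x)" using integrable_L_continuous[of j "k x"] by (simp add: h_def)
      then show ?thesis unfolding L_def h_def by (rule integral_restrict_Icc)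
    qed
    have "(\<integral>x. (\<integral>y. k x y \<partial>L j) \<partial>L j) = integral {0..1 - h} (\<lambda>x. \<integral>y. k x y \<partial>L j)"
      using LL.integrable_fst'[OF ik] unfolding h_def
      by (subst (1) L_def, intro integral_restrict_Icc) (simp add: L_def)
    also have "\<dots> = integral {0..1 - h} (\<lambda>x. integral {0..1 - h} (k x))"
      by (rule integral_cong) (use inner spL in auto)
    also have "\<dots> = C * s * integral {0..1 - h} (\<lambda>x. integral {0..1 - h} (\<lambda>y. incr_cov_bound \<alpha> \<beta> h x y))"
      by (simp add: k_def[abs_def] mult.assoc)
    also have "\<dots> \<le> C * s * (40 * h powr (1 + min 1 (2 * \<alpha> * \<beta>)))"
      using integral_incr_cov_bound_le[OF \<alpha> \<beta> h] C(1) by (intro mult_left_mono) (auto simp: s_def)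
    also have "\<dots> = 40 * C * (s * h powr (1 + min 1 (2 * \<alpha> * \<beta>)))" by simp
    also have "s * h powr (1 + min 1 (2 * \<alpha> * \<beta>)) = (2 powr - (1 + min 1 (2 * \<alpha> * \<beta>) - 2 * \<alpha> * \<beta>)) ^ j"
      unfolding s_def h_def powr_dyadic by (simp flip: power_mult_distrib powr_add) (simp add: algebra_simps)
    finally show ?thesis using R by auto
  qed
  show thesis by (rule that[of "40 * C"]) (use C(1) main in auto)
qed

lemma X_centred:
  assumes "\<omega> \<in> space M"
  shows "(\<integral>x. Z j x \<omega> ^ (2 * m) - mom m * v j x x ^ m \<partial>L j) = X m j \<omega> - (\<integral>x. mom m * v j x x ^ m \<partial>L j)"
  unfolding X_def by (rule Bochner_Integration.integral_diff[OF integrable_L_Z_power[OF assms] integrable_L_mean])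

lemma AE_X_centred: "AE \<omega> in M. (\<lambda>j. X m j \<omega> - (\<integral>x. mom m * v j x x ^ m \<partial>L j)) \<longlonglongrightarrow> 0"
proof -
  let ?Q = "\<lambda>j \<omega>. \<integral>x. Z j x \<omega> ^ (2 * m) - mom m * v j x x ^ m \<partial>L j"
  let ?r = "2 powr - (1 + min 1 (2 * \<alpha> * \<beta>) - 2 * \<alpha> * \<beta>) :: real"
  obtain C where C: "C \<ge> 0" "\<And>j. integrable M (\<lambda>\<omega>. (?Q j \<omega>)\<^sup>2) \<and> expectation (\<lambda>\<omega>. (?Q j \<omega>)\<^sup>2) \<le> C * ?r ^ j"
    using expectation_centred_square_le[of m] by blast
  \<comment> \<open>The exponent subtracted is 1 if \<open>2 * \<alpha> * \<beta> \<le> 1\<close>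
    and \<open>2 - 2 * \<alpha> * \<beta>\<close> otherwise; it is positive because
    \<open>\<alpha> * \<beta> < 1\<close>.\<close>
  have "?r < 1" using exponent_bounds[OF \<alpha> \<beta>] by (intro powr_less_one) (auto simp: min_def)
  then have "summable (\<lambda>j. C * ?r ^ j)" by (intro summable_mult summable_geometric) simp
  moreover have "?Q j \<in> borel_measurable M" for j
  proof -
    interpret L: finite_measure "L j" by (rule finite_measure_L)
    have Zs: "(\<lambda>z. Z j (snd z) (fst z)) \<in> borel_measurable (M \<Otimes>\<^sub>M L j)"
      using measurable_compose[OF measurable_pair_swap' Z_measurable[of j]] by (simp add: split_beta)
    have vs: "(\<lambda>z. v j (snd z) (snd z)) \<in> borel_measurable (M \<Otimes>\<^sub>M L j)"
      using measurable_compose[OF measurable_snd v_diag_measurable] .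
    show ?thesis
      by (rule L.borel_measurable_lebesgue_integral) (use Zs vs in \<open>simp add: split_beta\<close>)
  qed
  ultimately have "AE \<omega> in M. (\<lambda>j. ?Q j \<omega>) \<longlonglongrightarrow> 0"
    using C by (intro AE_LIMSEQ_0_if_summable_square[where a = "\<lambda>j. C * ?r ^ j"]) auto
  then show ?thesis
    by (rule AE_mp) (auto simp: X_centred)
qed

lemma mean_le: "(\<integral>x. mom m * v j x x ^ m \<partial>L j) \<le> mom m * 2 ^ m"
proof -
  interpret L: finite_measure "L j" by (rule finite_measure_L)
  have "(\<integral>x. mom m * v j x x ^ m \<partial>L j) \<le> (\<integral>x. mom m * 2 ^ m \<partial>L j)"
    by (rule integral_mono[OF integrable_L_mean])
      (use v_le_2 v_nonneg mom_nonneg in \<open>auto intro!: mult_left_mono power_mono\<close>)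
  also have "\<dots> = (1 - 1 / 2 ^ j) * (mom m * 2 ^ m)" by (simp add: measure_L)
  also have "\<dots> \<le> 1 * (mom m * 2 ^ m)" using mom_nonneg by (intro mult_right_mono) auto
  finally show ?thesis by simp
qed

lemma AE_X_bounded: "AE \<omega> in M. \<exists>C. \<forall>j. X m j \<omega> \<le> C"
  using AE_X_centred[of m]
proof eventually_elim
  case (elim \<omega>)
  then have "Bseq (\<lambda>j. X m j \<omega> - (\<integral>x. mom m * v j x x ^ m \<partial>L j))"
    by (intro convergent_imp_Bseq convergentI)
  then obtain K where K: "\<And>j. \<bar>X m j \<omega> - (\<integral>x. mom m * v j x x ^ m \<partial>L j)\<bar> \<le> K"
    by (auto simp: Bseq_def)
  have "X m j \<omega> \<le> K + mom m * 2 ^ m" for j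
    using K[of j] mean_le[of j m] by linarith
  then show ?case by blast
qed

text \<open>Only \<open>x\<close> in the right half is used, where the variance bound gives
  \<open>v j x x \<ge> 1 / 2\<close>; for \<open>h \<le> 1 / 4\<close> these points have measure at
  least \<open>1 / 4\<close>, and \<open>mom 1 = 1\<close>.\<close>

lemma eventually_mean_ge: "\<forall>\<^sub>F j in sequentially. 1 / 8 \<le> (\<integral>x. mom 1 * v j x x ^ 1 \<partial>L j)"
proof -
  obtain h0 where h0: "0 < h0" "\<And>x h. \<lbrakk>1 / 2 \<le> x; x + h \<le> 1; 0 < h; h \<le> h0\<rbrakk>
    \<Longrightarrow> h powr (2 * \<alpha> * \<beta>) / 2 \<le> incr_cov \<alpha> \<beta> h x x"
    using incr_cov_diag_ge[OF \<alpha> \<beta>] by blast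
  have "(\<lambda>j. (1 / 2) ^ j :: real) \<longlonglongrightarrow> 0" by (intro LIMSEQ_realpow_zero) auto
  then have "\<forall>\<^sub>F j in sequentially. (1 / 2) ^ j < min h0 (1 / 4)"
    using h0(1) by (intro order_tendstoD) auto
  then show ?thesis
  proof eventually_elim
    case (elim j)
    interpret L: finite_measure "L j" by (rule finite_measure_L)
    define h :: real where "h = 1 / 2 ^ j"
    have h: "0 < h" "h \<le> h0" "h \<le> 1 / 4" using elim by (auto simp: h_def power_divide)
    have S: "{1 / 2..1 - h} \<in> sets (L j)"
      unfolding L_def sets_restrict_space by (auto simp: h_def intro!: image_eqI[of _ _ "{1 / 2..1 - 1 / 2 ^ j}"])
    have mS: "measure (L j) {1 / 2..1 - h} = 1 / 2 - h"
      unfolding L_def by (subst measure_restrict_space) (use h in \<open>auto simp: h_def\<close>)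
    have "1 / 8 \<le> 1 / 2 * (1 / 2 - h)" using h by simp
    also have "\<dots> = (\<integral>x. 1 / 2 * indicator {1 / 2..1 - h} x \<partial>L j)"
      using S mS by simp
    also have "\<dots> \<le> (\<integral>x. mom 1 * v j x x ^ 1 \<partial>L j)"
    proof (rule integral_mono[OF _ integrable_L_mean])
      show "integrable (L j) (\<lambda>x. (1 / 2 :: real) * indicator {1 / 2..1 - h} x)"
        using S by (intro integrable_mult_right integrable_real_indicator) (auto simp: L.emeasure_eq_measure)
      fix x assume x: "x \<in> space (L j)"
      show "1 / 2 * indicator {1 / 2..1 - h} x \<le> mom 1 * v j x x ^ 1"
      proof (cases "x \<in> {1 / 2..1 - h}")
        case True
        have "(2 powr (2 * \<alpha> * \<beta>)) ^ j * (h powr (2 * \<alpha> * \<beta>) / 2) \<le> v j x x"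
          unfolding v_def h_def[symmetric] using h0(2)[of x h] True h by (intro mult_left_mono) auto
        then show ?thesis using True scale_step[of j] by (simp add: h_def mom_def)
      qed (use v_nonneg[OF x] in \<open>simp add: mom_def\<close>)
    qed
    finally show ?case .
  qed
qed

lemma AE_X1_ge: "AE \<omega> in M. \<forall>\<^sub>F j in sequentially. 1 / 16 \<le> X 1 j \<omega>"
  using AE_X_centred[of 1]
proof eventually_elim
  case (elim \<omega>)
  have "\<forall>\<^sub>F j in sequentially. - 1 / 16 < X 1 j \<omega> - (\<integral>x. mom 1 * v j x x ^ 1 \<partial>L j)"
    by (rule order_tendstoD(1)[OF elim]) simp
  with eventually_mean_ge show ?case by eventually_elim linarith
qed

section \<open>Arbitrary exponents by comparison with even ones\<close>

definition V :: "real \<Rightarrow> nat \<Rightarrow> 'a \<Rightarrow> real" where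
  "V p j \<omega> = (\<integral>x. \<bar>Z j x \<omega>\<bar> powr p \<partial>L j)"

lemma V_measurable [measurable]: "V p j \<in> borel_measurable M"
proof -
  interpret L: finite_measure "L j" by (rule finite_measure_L)
  have Zs: "(\<lambda>z. Z j (snd z) (fst z)) \<in> borel_measurable (M \<Otimes>\<^sub>M L j)"
    using measurable_compose[OF measurable_pair_swap' Z_measurable[of j]] by (simp add: split_beta)
  show ?thesis unfolding V_def[abs_def]
    by (rule L.borel_measurable_lebesgue_integral) (use Zs in \<open>simp add: split_beta\<close>)
qed

lemma V_eq_Lp_incr:
  assumes "0 < p"
  shows "V p j \<omega> = (2 powr (\<alpha> * \<beta> * p)) ^ j * Lp_incr p (\<lambda>t. B t \<omega>) (1 / 2 ^ j)"
proof -
  have "V p j \<omega> = (\<integral>x. (2 powr (\<alpha> * \<beta> * p)) ^ j * \<bar>B (x + 1 / 2 ^ j) \<omega> - B x \<omega>\<bar> powr p \<partial>L j)"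
    unfolding V_def
  proof (rule Bochner_Integration.integral_cong[OF refl])
    fix x assume x: "x \<in> space (L j)"
    have "((2 powr (\<alpha> * \<beta>)) ^ j) powr p = (2 powr (\<alpha> * \<beta> * p)) ^ j"
      by (simp add: powr_power powr_powr mult_ac)
    then show "\<bar>Z j x \<omega>\<bar> powr p = (2 powr (\<alpha> * \<beta> * p)) ^ j * \<bar>B (x + 1 / 2 ^ j) \<omega> - B x \<omega>\<bar> powr p"
      using x by (simp add: Z_eq abs_mult powr_mult)
  qed
  also have "\<dots> = (2 powr (\<alpha> * \<beta> * p)) ^ j * (\<integral>x. \<bar>B (x + 1 / 2 ^ j) \<omega> - B x \<omega>\<bar> powr p \<partial>L j)"
    by simp
  also have "(\<integral>x. \<bar>B (x + 1 / 2 ^ j) \<omega> - B x \<omega>\<bar> powr p \<partial>L j) = Lp_incr p (\<lambda>t. B t \<omega>) (1 / 2 ^ j)"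
    unfolding L_def Lp_incr_def set_lebesgue_integral_def by (subst integral_restrict_space) auto
  finally show ?thesis .
qed

lemma integrable_L_Z_powr:
  assumes "\<omega> \<in> space M" "0 < p"
  shows "integrable (L j) (\<lambda>x. \<bar>Z j x \<omega>\<bar> powr p)"
  using assms by (intro integrable_L_continuous continuous_on_powr' continuous_on_rabs continuous_on_Z continuous_on_const) auto

lemma V_le:
  assumes \<omega>: "\<omega> \<in> space M" and p: "0 < p" "p \<le> 2 * real m"
  shows "V p j \<omega> \<le> 1 + X m j \<omega>"
proof -
  interpret L: finite_measure "L j" by (rule finite_measure_L)
  have "V p j \<omega> \<le> (\<integral>x. 1 + Z j x \<omega> ^ (2 * m) \<partial>L j)"
    unfolding V_def
  proof (rule integral_mono[OF integrable_L_Z_powr[OF \<omega> p(1)]])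
    show "integrable (L j) (\<lambda>x. 1 + Z j x \<omega> ^ (2 * m))"
      by (intro Bochner_Integration.integrable_add integrable_L_Z_power \<omega>) simp
    show "\<bar>Z j x \<omega>\<bar> powr p \<le> 1 + Z j x \<omega> ^ (2 * m)" for x
    proof (cases "\<bar>Z j x \<omega>\<bar> \<le> 1")
      case True
      then have "\<bar>Z j x \<omega>\<bar> powr p \<le> 1" using p by (intro powr_le1) auto
      moreover have "0 \<le> Z j x \<omega> ^ (2 * m)" by (simp add: zero_le_even_power)
      ultimately show ?thesis by linarith
    next
      case False
      then have "\<bar>Z j x \<omega>\<bar> powr p \<le> \<bar>Z j x \<omega>\<bar> powr real (2 * m)" using p by (intro powr_mono) auto
      also have "\<dots> = Z j x \<omega> ^ (2 * m)" using False by (subst powr_realpow) (auto simp: power_even_abs)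
      finally show ?thesis by simp
    qed
  qed
  also have "\<dots> = (1 - 1 / 2 ^ j) + X m j \<omega>"
    unfolding X_def using integrable_L_Z_power[OF \<omega>, of j "2 * m"] by (simp add: measure_L)
  finally show ?thesis by (simp add: algebra_simps) (smt (verit) divide_nonneg_nonneg zero_le_power)
qed

text \<open>A substitute for interpolation that treats all \<open>p > 0\<close> alike. With
  \<open>y\<close> the square of the increment: \<open>y \<le> d\<close> is absorbed by
  \<open>d\<close>, \<open>y \<ge> 1 / e\<close> by \<open>e * y\<^sup>2\<close>, and in between
  \<open>y < 1 / e\<close> while \<open>(y / d) powr (p / 2)\<close> exceeds 1.\<close>

lemma X1_le:
  assumes \<omega>: "\<omega> \<in> space M" and p: "0 < p" and d: "0 < d" "0 < e"
  shows "X 1 j \<omega> \<le> d + e * X 2 j \<omega> + 1 / (e * d powr (p / 2)) * V p j \<omega>"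
proof -
  interpret L: finite_measure "L j" by (rule finite_measure_L)
  note i = integrable_L_Z_powr[OF \<omega> p, of j] integrable_L_Z_power[OF \<omega>, of j 4]
  have "X 1 j \<omega> \<le> (\<integral>x. d + e * Z j x \<omega> ^ 4 + 1 / (e * d powr (p / 2)) * \<bar>Z j x \<omega>\<bar> powr p \<partial>L j)"
    unfolding X_def
  proof (rule integral_mono[OF integrable_L_Z_power[OF \<omega>]])
    show "integrable (L j) (\<lambda>x. d + e * Z j x \<omega> ^ 4 + 1 / (e * d powr (p / 2)) * \<bar>Z j x \<omega>\<bar> powr p)"
      using i by (intro Bochner_Integration.integrable_add integrable_mult_right) auto
    fix x
    define y where "y = (Z j x \<omega>)\<^sup>2"
    have y0: "0 \<le> y" by (simp add: y_def)
    have y4: "Z j x \<omega> ^ 4 = y * y" by (simp add: y_def power4_eq_xxxx power2_eq_square)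
    have yp: "\<bar>Z j x \<omega>\<bar> powr p = y powr (p / 2)"
    proof -
      have "y = \<bar>Z j x \<omega>\<bar> powr 2" by (simp add: y_def)
      then show ?thesis by (simp only: powr_powr) simp
    qed
    have "y \<le> d + e * (y * y) + 1 / (e * d powr (p / 2)) * y powr (p / 2)"
    proof -
      consider "y \<le> d" | "1 / e \<le> y" | "d < y" "y < 1 / e" by linarith
      then show ?thesis
      proof cases
        case 1
        have "0 \<le> e * (y * y) + 1 / (e * d powr (p / 2)) * y powr (p / 2)"
          using d y0 by (intro add_nonneg_nonneg) auto
        then show ?thesis using 1 by linarith
      next
        case 2
        have "1 * y \<le> (e * y) * y" using 2 d y0 by (intro mult_right_mono) (auto simp: field_simps)
        moreover have "0 \<le> 1 / (e * d powr (p / 2)) * y powr (p / 2)" using d by simp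
        ultimately show ?thesis using d(1) by (simp only: mult.assoc mult_1)
      next
        case 3
        have "d powr (p / 2) \<le> y powr (p / 2)" using 3 d p by (intro powr_mono2) auto
        then have "1 / (e * d powr (p / 2)) * d powr (p / 2) \<le> 1 / (e * d powr (p / 2)) * y powr (p / 2)"
          using d by (intro mult_left_mono) auto
        then have "1 / e \<le> 1 / (e * d powr (p / 2)) * y powr (p / 2)" using d by simp
        moreover have "0 \<le> e * (y * y)" using d y0 by simp
        ultimately show ?thesis using 3 d(1) by linarith
      qed
    qed
    then show "Z j x \<omega> ^ (2 * 1) \<le> d + e * Z j x \<omega> ^ 4 + 1 / (e * d powr (p / 2)) * \<bar>Z j x \<omega>\<bar> powr p"
      unfolding y4 yp by (simp add: y_def)
  qed
  also have "\<dots> = (1 - 1 / 2 ^ j) * d + e * X 2 j \<omega> + 1 / (e * d powr (p / 2)) * V p j \<omega>"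
    unfolding X_def V_def using i by (simp add: measure_L)
  also have "(1 - 1 / 2 ^ j) * d \<le> 1 * d" using d by (intro mult_right_mono) auto
  finally show ?thesis by simp
qed

lemma AE_V_bounded:
  assumes p: "0 < p"
  shows "AE \<omega> in M. \<exists>C::nat. \<forall>j. V p j \<omega> \<le> C"
proof -
  obtain m :: nat where m: "p \<le> 2 * real m" using real_arch_simple[of "p / 2"] by (auto simp: field_simps)
  show ?thesis using AE_X_bounded[of m] AE_space
  proof eventually_elim
    case (elim \<omega>)
    then obtain C where C: "\<And>j. X m j \<omega> \<le> C" by blast
    obtain N :: nat where N: "1 + C \<le> N" using real_arch_simple by blast
    have "V p j \<omega> \<le> N" for j
      using V_le[OF elim(2) p m, of j] C[of j] N by linarith
    then show ?case by blast
  qed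
qed

text \<open>Second powers stay above \<open>1 / 16\<close> and fourth powers stay bounded, so
  vanishing \<open>p\<close>-th powers would contradict \<open>X1_le\<close>.\<close>

lemma AE_V_not_null:
  assumes p: "0 < p"
  shows "AE \<omega> in M. \<not> (\<lambda>j. V p j \<omega>) \<longlonglongrightarrow> 0"
  using AE_X_bounded[of 2] AE_X1_ge AE_space
proof eventually_elim
  case (elim \<omega>)
  then obtain C0 where C0: "\<And>j. X 2 j \<omega> \<le> C0" by blast
  define C where "C = max 1 C0"
  have C: "0 < C" "\<And>j. X 2 j \<omega> \<le> C" using C0 by (auto simp: C_def le_max_iff_disj)
  \<comment> \<open>Budget for the contradiction: \<open>d\<close> and the fourth-power term take
    \<open>1 / 64\<close> each and the \<open>V\<close> term less than \<open>1 / 32\<close>, in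
    total less than \<open>1 / 16\<close>.\<close>
  define e where "e = 1 / (64 * C)"
  define K where "K = 1 / (e * (1 / 64) powr (p / 2))"
  have e: "0 < e" using C by (simp add: e_def)
  have K: "0 < K" using e by (simp add: K_def)
  show ?case
  proof
    assume "(\<lambda>j. V p j \<omega>) \<longlonglongrightarrow> 0"
    then have "\<forall>\<^sub>F j in sequentially. V p j \<omega> < 1 / (32 * K)"
      using K by (intro order_tendstoD) auto
    with elim(2) have "\<forall>\<^sub>F j in sequentially. False"
    proof eventually_elim
      case (elim j)
      have "X 1 j \<omega> \<le> 1 / 64 + e * X 2 j \<omega> + K * V p j \<omega>"
        unfolding K_def using X1_le[OF \<open>\<omega> \<in> space M\<close> p _ e, of "1 / 64" j] by simp
      moreover have "e * X 2 j \<omega> \<le> e * C" using C e by (intro mult_left_mono) auto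
      moreover have "e * C = 1 / 64" using C by (simp add: e_def)
      moreover have "K * V p j \<omega> < K * (1 / (32 * K))" using elim(2) K by (intro mult_strict_left_mono) auto
      moreover have "K * (1 / (32 * K)) = 1 / 32" using K by simp
      ultimately show False using elim(1) by linarith
    qed
    then show False by simp
  qed
qed

section \<open>Measurability and probability of the two events\<close>

lemma path_Bes_iff:
  assumes "\<omega> \<in> space M" "1 \<le> p"
  shows "(\<lambda>t. B t \<omega>) \<in> Bes (\<alpha> * \<beta>) p \<longleftrightarrow> (\<exists>C::nat. \<forall>j. V p j \<omega> \<le> C)"
  using Bes_iff_dyadic[OF continuous_on_B[OF assms(1)] assms(2), of "\<alpha> * \<beta>"] \<alpha> \<beta> assms(2)
  by (simp add: V_eq_Lp_incr)

lemma path_bes_iff: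
  assumes "\<omega> \<in> space M" "1 \<le> p"
  shows "(\<lambda>t. B t \<omega>) \<in> bes (\<alpha> * \<beta>) p \<longleftrightarrow> (\<lambda>j. V p j \<omega>) \<longlonglongrightarrow> 0"
  using bes_iff_dyadic[OF continuous_on_B[OF assms(1)] assms(2), of "\<alpha> * \<beta>"] \<alpha> \<beta> assms(2)
  by (simp add: V_eq_Lp_incr)

lemma prob_Bes:
  assumes "1 \<le> p"
  shows "{\<omega> \<in> space M. (\<lambda>t. B t \<omega>) \<in> Bes (\<alpha> * \<beta>) p} \<in> sets M"
    and "prob {\<omega> \<in> space M. (\<lambda>t. B t \<omega>) \<in> Bes (\<alpha> * \<beta>) p} = 1"
proof -
  have eq: "{\<omega> \<in> space M. (\<lambda>t. B t \<omega>) \<in> Bes (\<alpha> * \<beta>) p} = {\<omega> \<in> space M. \<exists>C::nat. \<forall>j. V p j \<omega> \<le> C}"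
    using path_Bes_iff[OF _ assms] by auto
  show s: "{\<omega> \<in> space M. (\<lambda>t. B t \<omega>) \<in> Bes (\<alpha> * \<beta>) p} \<in> sets M"
    unfolding eq by measurable
  show "prob {\<omega> \<in> space M. (\<lambda>t. B t \<omega>) \<in> Bes (\<alpha> * \<beta>) p} = 1"
    using AE_V_bounded[of p] assms s unfolding eq by (subst prob_Collect_eq_1) auto
qed

lemma prob_bes:
  assumes "1 \<le> p"
  shows "{\<omega> \<in> space M. (\<lambda>t. B t \<omega>) \<in> bes (\<alpha> * \<beta>) p} \<in> sets M"
    and "prob {\<omega> \<in> space M. (\<lambda>t. B t \<omega>) \<in> bes (\<alpha> * \<beta>) p} = 0"
proof -
  have eq: "{\<omega> \<in> space M. (\<lambda>t. B t \<omega>) \<in> bes (\<alpha> * \<beta>) p} = {\<omega> \<in> space M. (\<lambda>j. V p j \<omega>) \<longlonglongrightarrow> 0}"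
    using path_bes_iff[OF _ assms] by auto
  show s: "{\<omega> \<in> space M. (\<lambda>t. B t \<omega>) \<in> bes (\<alpha> * \<beta>) p} \<in> sets M"
    unfolding eq by measurable
  show "prob {\<omega> \<in> space M. (\<lambda>t. B t \<omega>) \<in> bes (\<alpha> * \<beta>) p} = 0"
    using AE_V_not_null[of p] assms s unfolding eq by (subst prob_Collect_eq_0) auto
qed

end

theorem theorem3p1:
  fixes M :: "'a measure" and B :: "real \<Rightarrow> 'a \<Rightarrow> real" and \<alpha> \<beta> p :: real
  assumes "0 < \<alpha>" and "\<alpha> < 1"
    and "0 < \<beta>" and "\<beta> \<le> 1"
    and "1 / (\<alpha> * \<beta>) < p"
    and "bifractional_brownian_motion M {0..1} \<alpha> \<beta> B"
  shows "{\<omega> \<in> space M. (\<lambda>t. B t \<omega>) \<in> Bes (\<alpha> * \<beta>) p} \<in> sets M \<and>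
         measure M {\<omega> \<in> space M. (\<lambda>t. B t \<omega>) \<in> Bes (\<alpha> * \<beta>) p} = 1 \<and>
         {\<omega> \<in> space M. (\<lambda>t. B t \<omega>) \<in> bes (\<alpha> * \<beta>) p} \<in> sets M \<and>
         measure M {\<omega> \<in> space M. (\<lambda>t. B t \<omega>) \<in> bes (\<alpha> * \<beta>) p} = 0"
proof -
  interpret bifractional_path M B \<alpha> \<beta> by unfold_locales (use assms in auto)
  \<comment> \<open>Since \<open>\<alpha> * \<beta> < 1\<close>, the lower bound on \<open>p\<close>
    gives \<open>p \<ge> 1\<close>, the range in which the convexity arguments work.\<close>
  have "\<alpha> * \<beta> < 1" by (rule exponent_bounds(3)[OF assms(1-4)])
  then have "1 \<le> 1 / (\<alpha> * \<beta>)" using assms by (simp add: field_simps)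
  then have "1 \<le> p" using assms(5) by linarith
  then show ?thesis using prob_Bes prob_bes by blast
qed

end
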